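(* Fix a latent causal graph $\mathcal G_{\mathbf V}$ over the observed features $\mathbf V$ and let $\mathbf W_\star=\{\mathbf W_1,\mathbf W_2,\dots\}$ be a collection of subsets of $\mathbf V$, with associated queries $Q(\mathbf W_i)=P(\widehat Y_{\mathbf W_i}\mid\mathbf X)$. Then the maximal T-admissible set w.r.t. $\mathbf W_\star$ is unique and is given by $$\text{Max-T-Ad}(\mathbf W_\star)=\bigcap_{\mathbf W_i\in\mathbf W_\star}\big(\mathbf W_i\cup ND(\mathbf W_i)\big).$$ Moreover, for $\mathbf T\subseteq\mathbf V$, $\mathbf T\in\text{T-Ad}(\mathbf W_\star)$ if and only if $\mathbf T\subseteq\text{Max-T-Ad}(\mathbf W_\star)$.
   Context: Structural causal model (SCM): a tuple $\langle\mathbf U,\mathbf V,\mathcal F,P(\mathbf U)\rangle$ with exogenous variables $\mathbf U$, endogenous variables $\mathbf V=\{V_1,\dots,V_n\}$, functions $\mathcal F=\{f_{V_1},\dots,f_{V_n}\}$ determining $V_j\leftarrow f_{V_j}(\mathbf{Pa}_{V_j},\mathbf U_{V_j})$ with $\mathbf{Pa}_{V_j}\subseteq\mathbf V\setminus\{V_j\}$, $\mathbf U_{V_j}\subseteq\mathbf U$, and a distribution $P(\mathbf U)$. It induces a distribution $P(\mathbf V)$ and a causal diagram: vertices $\mathbf V$; a directed edge $V_j\to V_i$ if $V_j$ is an argument of $f_{V_i}$; a bidirected edge between $V_i$ and $V_j$ if $\mathbf U_{V_i},\mathbf U_{V_j}$ are not independent or $f_{V_i},f_{V_j}$ share an exogenous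 argument. Diagrams are acyclic in their directed edges. $\mathcal D(\cdot)$ denotes the domain of a variable or set of variables. Augmented SCM (ASCM) over an SCM $\mathcal M_0=\langle\mathbf U_0,\mathbf V_0,\mathcal F_0,P^0(\mathbf U_0)\rangle$: a tuple $\mathcal M=\langle\mathbf U,\{\mathbf V,\mathbf X,\widehat Y\},\mathcal F,P(\mathbf U)\rangle$ with $\mathbf U=\{\mathbf U_0,\mathbf U_{\mathbf X}\}$ (where $\mathbf U_{\mathbf X}$ may include, or be correlated with, variables of $\mathbf U_0$); $\mathbf V=\mathbf V_0$ the observed features; $\mathbf X$ an $m$-dimensional mixture variable (image); $\widehat Y$ the predicted label; $\mathcal F=\{\mathcal F_0,f_{\mathbf X},f_{\widehat Y}\}$, where $f_{\mathbf X}$ maps $\mathbf V\cup\mathbf U_{\mathbf X}$ to $\mathbf X$ and the classifier $f_{\widehat Y}$ maps a subset of $\{\mathbf V,\mathbf X\}$ to $\widehat Y$; and $P(\mathbf U_0)=P^0(\mathbf U_0)$. The causal diagram induced by $\mathcal M_0$ over $\mathbf V$ is the latent causal graph $\mathcal G_{\mathbf V}$. $\Omega$ denotes the space of all ASCMs over SCMs $\mathcal M_0$ inducing the fixed latent causal graph $\mathcal G_{\mathbf V}$. Generalized concept-based prediction: for $\mathbf T\subseteq\mathbf V$, $\Omega_{\mathrm{GCP}(\mathbf T)}=\{\mathcal M\in\Omega\mid f_{\widehat Y}:\mathcal D(\mathbf T)\to\mathcal D(\widehat Y)\}$. Query: for $\mathbf W\subseteq\mathbf V$, $Q(\mathbf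 W)=P(\widehat Y_{\mathbf W}\mid\mathbf X)$ is the collection of counterfactual quantities $P(\widehat Y_{\mathbf w'}\mid\mathbf X=\mathbf x)$ over values $\mathbf w'$ of $\mathbf W$ and $\mathbf x$ of $\mathbf X$, where $\widehat Y_{\mathbf w'}$ is the value of $\widehat Y$ in the model in which the functions of $\mathbf W$ are replaced by the constants $\mathbf w'$, with the same exogenous variables. Causal interpretability: a class $\Omega'\subset\Omega$ is causally interpretable w.r.t. a query $Q$ if $Q^{\mathcal M_1}=Q^{\mathcal M_2}$ for all $\mathcal M_1,\mathcal M_2\in\Omega'$ such that $P^{\mathcal M_1}(\mathbf V,\mathbf X,\widehat Y)=P^{\mathcal M_2}(\mathbf V,\mathbf X,\widehat Y)$. T-admissible: $\mathbf T\subseteq\mathbf V$ is T-admissible w.r.t. $\mathbf W_\star=\{\mathbf W_1,\mathbf W_2,\dots\}$ if $\Omega_{\mathrm{GCP}(\mathbf T)}$ is causally interpretable w.r.t. $Q(\mathbf W_i)$ for all $\mathbf W_i\in\mathbf W_\star$; $\text{T-Ad}(\mathbf W_\star)$ is the set of all T-admissible sets. A maximal T-admissible set, denoted $\text{Max-T-Ad}(\mathbf W_\star)$, is a set $\mathbf S\in\text{T-Ad}(\mathbf W_\star)$ such that $\mathbf S'\notin\text{T-Ad}(\mathbf W_\star)$ for every $\mathbf S'\supsetneq\mathbf S$. $ND(W)$ denotes the non-descendants of $W$ in $\mathcal G_{\mathbf V}$, and $ND(\mathbf W)=\bigcap_{W_i\in\mathbf W}ND(W_i)$.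
   Formalization: Every model in Ω is also required to have P(V=v)>0 for all v; domains of the features and of Ŷ are countable with at least two values (without these the claim fails); exogenous variables are countably many reals; P(·|X=x) is taken up to P(X)-null sets. *)

theory Defs
  imports "HOL-Probability.Probability"
begin

text \<open>
  Conventions.  The domain of a feature \<open>v\<close> is the set \<open>D v\<close>, that of the label is \<open>DY\<close>; both
  carry the discrete sigma-algebra.  The image takes values in \<open>real ^ 'm\<close>.  Exogenous variables are
  indexed by natural numbers and real-valued, with an arbitrary joint law.  An assignment to a set
  of variables is a function that is \<open>undefined\<close> outside that set.
\<close>

section \<open>Causal diagrams\<close>

text \<open>\<open>bidirected\<close> is stored as a symmetric irreflexive relation.\<close>

record 'v diagram =
  verts :: "'v set"
  directed :: "('v \<times> 'v) set"
  bidirected :: "('v \<times> 'v) set"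

definition causal_diagram :: "'v diagram \<Rightarrow> bool" where
  "causal_diagram G \<longleftrightarrow>
     finite (verts G) \<and>
     directed G \<subseteq> verts G \<times> verts G \<and> acyclic (directed G) \<and>
     bidirected G \<subseteq> verts G \<times> verts G \<and> sym (bidirected G) \<and> irrefl (bidirected G)"

text \<open>A vertex counts as its own descendant; this does not affect \<open>W \<union> nondescendants G W\<close>.\<close>

definition descendants :: "'v diagram \<Rightarrow> 'v \<Rightarrow> 'v set" where
  "descendants G w = {v. (w, v) \<in> (directed G)\<^sup>*}"

definition nondescendants :: "'v diagram \<Rightarrow> 'v set \<Rightarrow> 'v set" where
  "nondescendants G W = verts G \<inter> (\<Inter>w\<in>W. verts G - descendants G w)"


section \<open>Structural causal models\<close>

record ('v, 'a) scm =
  exo :: "nat set"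
  endo :: "'v set"
  parents :: "'v \<Rightarrow> 'v set"
  exo_args :: "'v \<Rightarrow> nat set"
  mech :: "'v \<Rightarrow> ('v \<Rightarrow> 'a) \<times> (nat \<Rightarrow> real) \<Rightarrow> 'a"
  exo_law :: "(nat \<Rightarrow> real) measure"

abbreviation feature_space :: "('v \<Rightarrow> 'a set) \<Rightarrow> 'v set \<Rightarrow> ('v \<Rightarrow> 'a) measure" where
  "feature_space D S \<equiv> Pi\<^sub>M S (\<lambda>v. count_space (D v))"

abbreviation exo_space :: "nat set \<Rightarrow> (nat \<Rightarrow> real) measure" where
  "exo_space S \<equiv> Pi\<^sub>M S (\<lambda>_. borel)"

definition scm_directed :: "('v, 'a) scm \<Rightarrow> ('v \<times> 'v) set" where
  "scm_directed N = {(j, i). i \<in> endo N \<and> j \<in> parents N i}"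

definition scm_bidirected :: "('v, 'a) scm \<Rightarrow> ('v \<times> 'v) set" where
  "scm_bidirected N =
     {(i, j). i \<in> endo N \<and> j \<in> endo N \<and> i \<noteq> j \<and>
        (exo_args N i \<inter> exo_args N j \<noteq> {} \<or>
         \<not> prob_space.indep_var (exo_law N)
             (exo_space (exo_args N i)) (\<lambda>u. restrict u (exo_args N i))
             (exo_space (exo_args N j)) (\<lambda>u. restrict u (exo_args N j)))}"

definition scm_diagram :: "('v, 'a) scm \<Rightarrow> 'v diagram" where
  "scm_diagram N =
     \<lparr>verts = endo N, directed = scm_directed N, bidirected = scm_bidirected N\<rparr>"

definition is_scm :: "('v \<Rightarrow> 'a set) \<Rightarrow> ('v, 'a) scm \<Rightarrow> bool" where
  "is_scm D N \<longleftrightarrow>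
     finite (endo N) \<and>
     (\<forall>v\<in>endo N. parents N v \<subseteq> endo N - {v} \<and> exo_args N v \<subseteq> exo N \<and>
        mech N v \<in> feature_space D (parents N v) \<Otimes>\<^sub>M exo_space (exo_args N v)
                     \<rightarrow>\<^sub>M count_space (D v)) \<and>
     acyclic (scm_directed N) \<and>
     prob_space (exo_law N) \<and> sets (exo_law N) = sets (exo_space (exo N))"

text \<open>By acyclicity the structural equations have exactly one solution.\<close>

definition scm_solution :: "('v, 'a) scm \<Rightarrow> (nat \<Rightarrow> real) \<Rightarrow> 'v \<Rightarrow> 'a" where
  "scm_solution N u =
     (THE x. x \<in> extensional (endo N) \<and>
        (\<forall>v\<in>endo N. x v = mech N v (restrict x (parents N v), restrict u (exo_args N v))))"

definition scm_dist :: "('v \<Rightarrow> 'a set) \<Rightarrow> ('v, 'a) scm \<Rightarrow> ('v \<Rightarrow> 'a) measure" where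
  "scm_dist D N = distr (exo_law N) (feature_space D (endo N)) (scm_solution N)"

definition positive_dist :: "('v \<Rightarrow> 'a set) \<Rightarrow> ('v, 'a) scm \<Rightarrow> bool" where
  "positive_dist D N \<longleftrightarrow> (\<forall>x \<in> Pi\<^sub>E (endo N) D. measure (scm_dist D N) {x} > 0)"

definition scm_do :: "('v, 'a) scm \<Rightarrow> 'v set \<Rightarrow> ('v \<Rightarrow> 'a) \<Rightarrow> ('v, 'a) scm" where
  "scm_do N W w =
     N\<lparr>parents := (\<lambda>v. if v \<in> W then {} else parents N v),
       exo_args := (\<lambda>v. if v \<in> W then {} else exo_args N v),
       mech := (\<lambda>v. if v \<in> W then (\<lambda>_. w v) else mech N v)\<rparr>"


section \<open>Augmented structural causal models\<close>

text \<open>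
  The exogenous variables of the augmented model are \<open>exo (base M) \<union> image_exo M\<close>; the two sets may
  overlap and be dependent under \<open>full_law M\<close>.
\<close>

record ('v, 'a, 'm::finite, 'y) ascm =
  base :: "('v, 'a) scm"
  image_exo :: "nat set"
  image_fn :: "('v \<Rightarrow> 'a) \<times> (nat \<Rightarrow> real) \<Rightarrow> real ^ 'm"
  label_fn :: "('v \<Rightarrow> 'a) \<times> (real ^ 'm) \<Rightarrow> 'y"
  full_law :: "(nat \<Rightarrow> real) measure"

definition is_ascm ::
  "('v \<Rightarrow> 'a set) \<Rightarrow> 'y set \<Rightarrow> ('v, 'a, 'm::finite, 'y) ascm \<Rightarrow> bool" where
  "is_ascm D DY M \<longleftrightarrow>
     is_scm D (base M) \<and>
     image_fn M \<in> feature_space D (endo (base M)) \<Otimes>\<^sub>M exo_space (image_exo M) \<rightarrow>\<^sub>M borel \<and>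
     label_fn M \<in> feature_space D (endo (base M)) \<Otimes>\<^sub>M borel \<rightarrow>\<^sub>M count_space DY \<and>
     prob_space (full_law M) \<and>
     sets (full_law M) = sets (exo_space (exo (base M) \<union> image_exo M)) \<and>
     distr (full_law M) (exo_space (exo (base M))) (\<lambda>u. restrict u (exo (base M)))
       = exo_law (base M)"

definition features :: "('v, 'a, 'm::finite, 'y) ascm \<Rightarrow> (nat \<Rightarrow> real) \<Rightarrow> 'v \<Rightarrow> 'a" where
  "features M u = scm_solution (base M) u"

definition image_var :: "('v, 'a, 'm::finite, 'y) ascm \<Rightarrow> (nat \<Rightarrow> real) \<Rightarrow> real ^ 'm" where
  "image_var M u = image_fn M (features M u, restrict u (image_exo M))"

definition label_var :: "('v, 'a, 'm::finite, 'y) ascm \<Rightarrow> (nat \<Rightarrow> real) \<Rightarrow> 'y" where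
  "label_var M u = label_fn M (features M u, image_var M u)"

definition ascm_do ::
  "('v, 'a, 'm::finite, 'y) ascm \<Rightarrow> 'v set \<Rightarrow> ('v \<Rightarrow> 'a) \<Rightarrow> ('v, 'a, 'm, 'y) ascm" where
  "ascm_do M W w = M\<lparr>base := scm_do (base M) W w\<rparr>"

definition joint_dist ::
  "('v \<Rightarrow> 'a set) \<Rightarrow> 'y set \<Rightarrow> ('v, 'a, 'm::finite, 'y) ascm
     \<Rightarrow> (('v \<Rightarrow> 'a) \<times> (real ^ 'm) \<times> 'y) measure" where
  "joint_dist D DY M =
     distr (full_law M) (feature_space D (endo (base M)) \<Otimes>\<^sub>M borel \<Otimes>\<^sub>M count_space DY)
       (\<lambda>u. (features M u, image_var M u, label_var M u))"

text \<open>
  Strict positivity of the feature distribution is needed: otherwise the observed joint law leaves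
  the classifier undetermined at feature values of probability zero, which interventions can reach.
\<close>

definition Omega ::
  "('v \<Rightarrow> 'a set) \<Rightarrow> 'y set \<Rightarrow> 'v diagram \<Rightarrow> ('v, 'a, 'm::finite, 'y) ascm set" where
  "Omega D DY G =
     {M. is_ascm D DY M \<and> scm_diagram (base M) = G \<and> positive_dist D (base M)}"

text \<open>A classifier \<open>D(T) \<rightarrow> DY\<close> is a \<open>label_fn\<close> that factors through the restriction to \<open>T\<close>.\<close>

definition Omega_GCP ::
  "('v \<Rightarrow> 'a set) \<Rightarrow> 'y set \<Rightarrow> 'v diagram \<Rightarrow> 'v set \<Rightarrow> ('v, 'a, 'm::finite, 'y) ascm set" where
  "Omega_GCP D DY G T =
     {M \<in> Omega D DY G.
        \<exists>h \<in> Pi\<^sub>E T D \<rightarrow> DY. \<forall>v \<in> Pi\<^sub>E (verts G) D. \<forall>x. label_fn M (v, x) = h (restrict v T)}"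


section \<open>Queries and admissibility\<close>

text \<open>
  The image may be continuous, so \<open>x \<mapsto> P(A | X = x)\<close> is determined only up to null sets of the
  law of \<open>X\<close>.  We represent it by the class of all its versions, i.e. of the measurable \<open>g\<close> for which
  \<open>g(X)\<close> is the conditional expectation of the indicator of \<open>A\<close> given the sigma-algebra of \<open>X\<close>.
\<close>

definition cond_prob_given ::
  "'u measure \<Rightarrow> ('u \<Rightarrow> 'x::topological_space) \<Rightarrow> 'u set \<Rightarrow> ('x \<Rightarrow> real) set" where
  "cond_prob_given P X A =
     {g \<in> borel_measurable borel.
        AE u in P. g (X u) = real_cond_exp P (vimage_algebra (space P) X borel) (indicator A) u}"

text \<open>\<open>P(Y\<^sub>w = y | X)\<close>: the label is counterfactual, the image is factual.\<close>

definition query ::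
  "('v \<Rightarrow> 'a set) \<Rightarrow> 'y set \<Rightarrow> 'v set \<Rightarrow> ('v, 'a, 'm::finite, 'y) ascm
     \<Rightarrow> ('v \<Rightarrow> 'a) \<Rightarrow> 'y \<Rightarrow> (real ^ 'm \<Rightarrow> real) set" where
  "query D DY W M =
     (\<lambda>w \<in> Pi\<^sub>E W D. \<lambda>y \<in> DY.
        cond_prob_given (full_law M) (image_var M)
          {u \<in> space (full_law M). label_var (ascm_do M W w) u = y})"

definition causally_interpretable ::
  "('v \<Rightarrow> 'a set) \<Rightarrow> 'y set \<Rightarrow> ('v, 'a, 'm::finite, 'y) ascm set
     \<Rightarrow> (('v, 'a, 'm, 'y) ascm \<Rightarrow> 'q) \<Rightarrow> bool" where
  "causally_interpretable D DY C Q \<longleftrightarrow>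
     (\<forall>M1\<in>C. \<forall>M2\<in>C. joint_dist D DY M1 = joint_dist D DY M2 \<longrightarrow> Q M1 = Q M2)"

text \<open>The argument of type \<open>'m itself\<close> passes the dimension of the image.\<close>

definition T_Ad ::
  "'m::finite itself \<Rightarrow> ('v \<Rightarrow> 'a set) \<Rightarrow> 'y set \<Rightarrow> 'v diagram \<Rightarrow> 'v set set \<Rightarrow> 'v set set" where
  "T_Ad m D DY G Ws =
     {T. T \<subseteq> verts G \<and>
         (\<forall>W\<in>Ws. causally_interpretable D DY
            (Omega_GCP D DY G T :: ('v, 'a, 'm, 'y) ascm set) (query D DY W))}"

definition is_Max_T_Ad ::
  "'m::finite itself \<Rightarrow> ('v \<Rightarrow> 'a set) \<Rightarrow> 'y set \<Rightarrow> 'v diagram \<Rightarrow> 'v set set \<Rightarrow> 'v set \<Rightarrow> bool" where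
  "is_Max_T_Ad m D DY G Ws S \<longleftrightarrow>
     S \<in> T_Ad m D DY G Ws \<and> (\<forall>S'. S \<subset> S' \<longrightarrow> S' \<notin> T_Ad m D DY G Ws)"

definition Max_T_Ad ::
  "'m::finite itself \<Rightarrow> ('v \<Rightarrow> 'a set) \<Rightarrow> 'y set \<Rightarrow> 'v diagram \<Rightarrow> 'v set set \<Rightarrow> 'v set" where
  "Max_T_Ad m D DY G Ws = (THE S. is_Max_T_Ad m D DY G Ws S)"

end

theory Submission
  imports Defs
begin

text \<open>
  If \<open>T \<subseteq> W \<union> ND(W)\<close>, then intervening on \<open>W\<close> leaves every concept in \<open>T - W\<close> at its
  factual value, so the counterfactual label is a function of the factual features; positivity makes
  that function identifiable, and conditioning on \<open>X\<close> only involves the joint law of features and image.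

  Conversely, let \<open>t \<in> T - W\<close> be a descendant of \<open>W\<close>.  In one model all features are independent
  noise.  In the other, each descendant outside \<open>W\<close> of \<open>W\<close> swaps two equiprobable values \<open>a\<close>, \<open>b\<close> of
  its noise whenever one chosen parent, which is in \<open>W\<close> or itself such a descendant, equals \<open>b\<close>.
  The swaps do not change the joint law, but they propagate an intervention on \<open>W\<close> to \<open>t\<close>.  With an
  image that encodes all features and a label that tests whether \<open>t\<close> is at \<open>a\<close>, the queries differ.
\<close>

section \<open>Solutions of structural equations\<close>

lemma is_scmD:
  assumes "is_scm D N"
  shows "finite (endo N)" "acyclic (scm_directed N)" "prob_space (exo_law N)"
    "sets (exo_law N) = sets (exo_space (exo N))"
    "v \<in> endo N \<Longrightarrow> parents N v \<subseteq> endo N - {v}"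
    "v \<in> endo N \<Longrightarrow> exo_args N v \<subseteq> exo N"
    "v \<in> endo N \<Longrightarrow> mech N v \<in> feature_space D (parents N v) \<Otimes>\<^sub>M exo_space (exo_args N v)
                     \<rightarrow>\<^sub>M count_space (D v)"
  using assms unfolding is_scm_def by auto

lemma wf_scm_directed:
  assumes "is_scm D N"
  shows "wf (scm_directed N)"
proof (rule finite_acyclic_wf)
  have "scm_directed N \<subseteq> endo N \<times> endo N"
    using is_scmD(5)[OF assms] by (auto simp: scm_directed_def)
  then show "finite (scm_directed N)"
    using is_scmD(1)[OF assms] by (meson finite_SigmaI finite_subset)
qed (rule is_scmD(2)[OF assms])

text \<open>Acyclicity on a finite vertex set makes the edge relation well-founded, so the solution
  arises by recursion along edges, and two solutions agree by induction along edges.\<close>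

lemma scm_solution_ex1:
  assumes "is_scm D N"
  shows "\<exists>!x. x \<in> extensional (endo N) \<and>
        (\<forall>v\<in>endo N. x v = mech N v (restrict x (parents N v), restrict u (exo_args N v)))"
proof -
  note wf = wf_scm_directed[OF assms]
  \<comment> \<open>Setting the value to \<open>undefined\<close> off \<open>endo N\<close> makes
    the fixpoint extensional. The functional is admissible because a mechanism sees only the
    parents.\<close>
  define F where "F x v = (if v \<in> endo N
    then mech N v (restrict x (parents N v), restrict u (exo_args N v)) else undefined)" for x v
  define x where "x = wfrec (scm_directed N) F"
  have eq: "x = F x"
    unfolding x_def
  proof (rule wfrec_fixpoint[OF wf])
    show "adm_wf (scm_directed N) F"
      unfolding adm_wf_def
    proof (intro allI impI)
      fix f g :: "'a \<Rightarrow> 'b" and v assume "\<forall>z. (z, v) \<in> scm_directed N \<longrightarrow> f z = g z"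
      then have "v \<in> endo N \<Longrightarrow> restrict f (parents N v) = restrict g (parents N v)"
        by (auto simp: scm_directed_def fun_eq_iff restrict_def)
      then show "F f v = F g v"
        by (simp add: F_def)
    qed
  qed
  show ?thesis
  proof (rule ex1I[of _ x])
    show "x \<in> extensional (endo N) \<and>
        (\<forall>v\<in>endo N. x v = mech N v (restrict x (parents N v), restrict u (exo_args N v)))"
    proof (intro conjI ballI)
      show "x \<in> extensional (endo N)"
        unfolding extensional_def by (subst eq) (simp add: F_def)
      fix v assume "v \<in> endo N"
      then show "x v = mech N v (restrict x (parents N v), restrict u (exo_args N v))"
        by (subst eq) (simp add: F_def)
    qed
  next
    fix y assume y: "y \<in> extensional (endo N) \<and>
        (\<forall>v\<in>endo N. y v = mech N v (restrict y (parents N v), restrict u (exo_args N v)))"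
    show "y = x"
    proof
      fix v show "y v = x v"
        using wf
      proof (induction v rule: wf_induct_rule)
        case (less v)
        show ?case
        proof (cases "v \<in> endo N")
          case True
          then have "restrict y (parents N v) = restrict x (parents N v)"
            using less by (auto simp: scm_directed_def fun_eq_iff restrict_def)
          moreover have "x v = F x v" using eq by metis
          ultimately show ?thesis
            using y True by (simp add: F_def)
        next
          case False
          then show ?thesis
            using y by (subst eq) (simp add: F_def extensional_def)
        qed
      qed
    qed
  qed
qed

lemma scm_solution_extensional:
  assumes "is_scm D N"
  shows "scm_solution N u \<in> extensional (endo N)"
  using theI'[OF scm_solution_ex1[OF assms, of u]] unfolding scm_solution_def by blast

lemma scm_solution_eq:
  assumes "is_scm D N" "v \<in> endo N"
  shows "scm_solution N u v =
    mech N v (restrict (scm_solution N u) (parents N v), restrict u (exo_args N v))"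
  using theI'[OF scm_solution_ex1[OF assms(1), of u]] assms(2) unfolding scm_solution_def by blast

lemma scm_solution_eqI:
  assumes "is_scm D N" "x \<in> extensional (endo N)"
    and "\<And>v. v \<in> endo N \<Longrightarrow>
      x v = mech N v (restrict x (parents N v), restrict u (exo_args N v))"
  shows "scm_solution N u = x"
  unfolding scm_solution_def
  by (rule the1_equality[OF scm_solution_ex1[OF assms(1)]]) (use assms in auto)

text \<open>The index set \<open>E\<close> may exceed \<open>exo N\<close>, so that the result also
  covers the law of an augmented model, which carries the exogenous variables of the image as
  well.\<close>

lemma scm_solution_component_measurable:
  assumes N: "is_scm D N" and E: "exo N \<subseteq> E" and v: "v \<in> endo N"
  shows "(\<lambda>u. scm_solution N u v) \<in> exo_space E \<rightarrow>\<^sub>M count_space (D v)"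
  using wf_scm_directed[OF N] v
proof (induction v rule: wf_induct_rule)
  case (less v)
  have "(\<lambda>u. \<lambda>p\<in>parents N v. scm_solution N u p) \<in> exo_space E \<rightarrow>\<^sub>M feature_space D (parents N v)"
    using less is_scmD(5)[OF N less(2)]
    by (intro measurable_restrict) (auto simp: scm_directed_def)
  moreover have "(\<lambda>u. restrict u (exo_args N v)) \<in> exo_space E \<rightarrow>\<^sub>M exo_space (exo_args N v)"
    using is_scmD(6)[OF N less(2)] E by (intro measurable_restrict_subset) auto
  ultimately have "(\<lambda>u. mech N v (restrict (scm_solution N u) (parents N v),
      restrict u (exo_args N v))) \<in> exo_space E \<rightarrow>\<^sub>M count_space (D v)"
    by (intro measurable_compose[OF _ is_scmD(7)[OF N less(2)]] measurable_Pair)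
      (auto simp: restrict_def)
  then show ?case
    using scm_solution_eq[OF N less(2)] by simp
qed

lemma scm_solution_measurable:
  assumes N: "is_scm D N" and E: "exo N \<subseteq> E"
  shows "scm_solution N \<in> exo_space E \<rightarrow>\<^sub>M feature_space D (endo N)"
proof -
  have "(\<lambda>u. \<lambda>v\<in>endo N. scm_solution N u v) \<in> exo_space E \<rightarrow>\<^sub>M feature_space D (endo N)"
    using scm_solution_component_measurable[OF N E] by (intro measurable_restrict)
  also have "(\<lambda>u. \<lambda>v\<in>endo N. scm_solution N u v) = scm_solution N"
    using scm_solution_extensional[OF N] by (simp add: extensional_restrict)
  finally show ?thesis .
qed

text \<open>Measurability of a mechanism bounds its values only on points of the underlying space,
  while \<open>u\<close> is arbitrary here. Restricting \<open>u\<close> to \<open>exo N\<close>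
  moves it into that space and leaves the solution unchanged.\<close>

lemma scm_solution_in_PiE:
  assumes N: "is_scm D N"
  shows "scm_solution N u \<in> Pi\<^sub>E (endo N) D"
proof (rule PiE_I)
  fix v assume v: "v \<in> endo N"
  have "scm_solution N (restrict u (exo N)) = scm_solution N u"
  proof (rule scm_solution_eqI[OF N scm_solution_extensional[OF N]])
    fix v assume v: "v \<in> endo N"
    have "restrict (restrict u (exo N)) (exo_args N v) = restrict u (exo_args N v)"
      using is_scmD(6)[OF N v] by (auto simp: restrict_def fun_eq_iff)
    then show "scm_solution N u v = mech N v (restrict (scm_solution N u) (parents N v),
        restrict (restrict u (exo N)) (exo_args N v))"
      using scm_solution_eq[OF N v, of u] by simp
  qed
  moreover have "restrict u (exo N) \<in> space (exo_space (exo N))"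
    by (simp add: space_PiM)
  ultimately show "scm_solution N u v \<in> D v"
    using measurable_space[OF scm_solution_component_measurable[OF N order_refl v]] by force
qed (use scm_solution_extensional[OF N] in \<open>auto simp: extensional_def\<close>)

text \<open>Singletons are finite boxes, and every set of assignments is a countable union of
  singletons. Hence measurability on the feature space is automatic.\<close>

lemma sets_feature_space:
  assumes "finite S" "\<And>v. v \<in> S \<Longrightarrow> countable (D v)"
  shows "sets (feature_space D S) = Pow (Pi\<^sub>E S D)"
proof
  show "sets (feature_space D S) \<subseteq> Pow (Pi\<^sub>E S D)"
    using sets.space_closed[of "feature_space D S"] by (simp add: space_PiM)
  show "Pow (Pi\<^sub>E S D) \<subseteq> sets (feature_space D S)"
  proof
    fix B assume B: "B \<in> Pow (Pi\<^sub>E S D)"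
    then have "countable B"
      using countable_PiE[OF assms(1), of D] assms(2) by (auto intro: countable_subset)
    moreover have "{x} \<in> sets (feature_space D S)" if "x \<in> B" for x
    proof -
      have "x \<in> Pi\<^sub>E S D" using B that by auto
      then have "{x} = Pi\<^sub>E S (\<lambda>v. {x v})"
        by (simp add: PiE_iff PiE_singleton)
      moreover have "Pi\<^sub>E S (\<lambda>v. {x v}) \<in> sets (feature_space D S)"
        using \<open>x \<in> Pi\<^sub>E S D\<close> by (intro sets_PiM_I_finite[OF assms(1)]) auto
      ultimately show ?thesis by simp
    qed
    ultimately show "B \<in> sets (feature_space D S)"
      by (metis sets.countable)
  qed
qed

section \<open>Interventions and their effect on non-descendants\<close>

lemma is_scm_do:
  assumes N: "is_scm D N" and w: "w \<in> Pi\<^sub>E W D"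
  shows "is_scm D (scm_do N W w)"
proof -
  have "acyclic (scm_directed (scm_do N W w))"
    by (rule acyclic_subset[OF is_scmD(2)[OF N]])
      (auto simp: scm_directed_def scm_do_def split: if_splits)
  moreover have "(\<lambda>_. w v) \<in> feature_space D {} \<Otimes>\<^sub>M exo_space {} \<rightarrow>\<^sub>M count_space (D v)"
    if "v \<in> W" for v
    using w that by (intro measurable_const) auto
  ultimately show ?thesis
    using N unfolding is_scm_def by (auto simp: scm_do_def)
qed

lemma scm_do_simps [simp]:
  "endo (scm_do N W w) = endo N" "exo (scm_do N W w) = exo N"
  by (simp_all add: scm_do_def)

lemma scm_solution_do_in:
  assumes N: "is_scm D N" and w: "w \<in> Pi\<^sub>E W D" and v: "v \<in> W" "v \<in> endo N"
  shows "scm_solution (scm_do N W w) u v = w v"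
  using scm_solution_eq[OF is_scm_do[OF N w], of v u] v by (simp add: scm_do_def)

lemma scm_solution_do_notin:
  assumes N: "is_scm D N" and w: "w \<in> Pi\<^sub>E W D" and v: "v \<notin> W" "v \<in> endo N"
  shows "scm_solution (scm_do N W w) u v =
    mech N v (restrict (scm_solution (scm_do N W w) u) (parents N v), restrict u (exo_args N v))"
  using scm_solution_eq[OF is_scm_do[OF N w], of v u] v by (simp add: scm_do_def)

lemma nondescendants_iff:
  "v \<in> nondescendants G W \<longleftrightarrow> v \<in> verts G \<and> (\<forall>w\<in>W. (w, v) \<notin> (directed G)\<^sup>*)"
  unfolding nondescendants_def descendants_def by blast

text \<open>Induction along edges: a parent of a non-descendant of \<open>W\<close> is again a
  non-descendant outside \<open>W\<close>, so the mechanism receives the same parent values and the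
  same noise in both models.\<close>

lemma scm_solution_do_nondescendant:
  assumes N: "is_scm D N" and w: "w \<in> Pi\<^sub>E W D"
    and v: "v \<in> nondescendants (scm_diagram N) W" "v \<notin> W"
  shows "scm_solution (scm_do N W w) u v = scm_solution N u v"
  using wf_scm_directed[OF N] v
proof (induction v rule: wf_induct_rule)
  case (less v)
  have v: "v \<in> endo N"
    using less(2) by (auto simp: nondescendants_iff scm_diagram_def)
  have "scm_solution (scm_do N W w) u p = scm_solution N u p" if p: "p \<in> parents N v" for p
  proof (rule less(1))
    show edge: "(p, v) \<in> scm_directed N"
      using p v by (simp add: scm_directed_def)
    have nd: "(x, v) \<notin> (scm_directed N)\<^sup>*" if "x \<in> W" for x
      using less(2) that by (simp add: nondescendants_iff scm_diagram_def)
    from edge nd show "p \<notin> W"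
      by blast
    from edge nd have "(x, p) \<notin> (scm_directed N)\<^sup>*" if "x \<in> W" for x
      using that by (meson rtrancl_into_rtrancl)
    then show "p \<in> nondescendants (scm_diagram N) W"
      using is_scmD(5)[OF N v] p
      by (auto simp: nondescendants_iff scm_diagram_def)
  qed
  then have "restrict (scm_solution (scm_do N W w) u) (parents N v)
      = restrict (scm_solution N u) (parents N v)"
    by (auto simp: restrict_def fun_eq_iff)
  then show ?case
    using scm_solution_do_notin[OF N w less(3) v] scm_solution_eq[OF N v] by simp
qed

section \<open>Versions of conditional probabilities\<close>

text \<open>The preimages of Borel sets under \<open>X\<close> are all the events of the
  conditioning sigma-algebra, so versions are characterised by integrals over them. In this form
  they can be compared across probability spaces.\<close>

lemma cond_prob_given_iff:
  assumes P: "prob_space P" and X [measurable]: "X \<in> P \<rightarrow>\<^sub>M borel" and A: "A \<in> sets P"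
  shows "g \<in> cond_prob_given P X A \<longleftrightarrow> g \<in> borel_measurable borel \<and> integrable P (\<lambda>u. g (X u)) \<and>
    (\<forall>S\<in>sets borel. (\<integral>u\<in>X -` S \<inter> space P. g (X u) \<partial>P) = measure P (A \<inter> (X -` S \<inter> space P)))"
    (is "_ \<longleftrightarrow> ?R")
proof -
  interpret prob_space P by fact
  let ?F = "vimage_algebra (space P) X borel"
  have setsF: "sets ?F = {X -` S \<inter> space P | S. S \<in> sets borel}"
    by (rule sets_vimage_algebra2) simp
  have "subalgebra P ?F"
    unfolding subalgebra_def setsF using X by (auto intro: measurable_sets)
  then interpret sigma_finite_subalgebra P ?F
    by (intro finite_measure_subalgebra_is_sigma_finite)
      (simp add: finite_measure_subalgebra_def finite_measure_subalgebra_axioms_def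
        finite_measure_axioms)
  have XF: "X \<in> ?F \<rightarrow>\<^sub>M borel" by (rule measurable_vimage_algebra1) simp
  have int: "integrable P (indicator A :: _ \<Rightarrow> real)"
    using A by (simp add: integrable_indicator_iff emeasure_eq_measure)
  have ind: "(\<integral>u\<in>B. indicator A u \<partial>P) = measure P (A \<inter> B)" if "B \<in> sets ?F" for B
  proof -
    have "B \<in> sets P" using that \<open>subalgebra P ?F\<close> by (auto simp: subalgebra_def)
    have "(\<integral>u\<in>B. indicator A u \<partial>P) = integral\<^sup>L P (indicator (A \<inter> B) :: _ \<Rightarrow> real)"
      unfolding set_lebesgue_integral_def
      by (intro Bochner_Integration.integral_cong) (auto simp: indicator_def)
    then show ?thesis
      using sets.Int[OF A \<open>B \<in> sets P\<close>] by (simp add: sets.Int_space_eq2 del: sets.Int)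
  qed
  show ?thesis
  proof
    assume g: "g \<in> cond_prob_given P X A"
    then have [measurable]: "g \<in> borel_measurable borel"
      and ae: "AE u in P. real_cond_exp P ?F (indicator A) u = g (X u)"
      by (auto simp: cond_prob_given_def)
    have "integrable P (\<lambda>u. g (X u))"
      using integrable_cong_AE[OF _ _ ae] real_cond_exp_int(1)[OF int] by simp
    moreover have "(\<integral>u\<in>X -` S \<inter> space P. g (X u) \<partial>P) = measure P (A \<inter> (X -` S \<inter> space P))"
      if [measurable]: "S \<in> sets borel" for S
    proof -
      have B: "X -` S \<inter> space P \<in> sets ?F" using setsF that by auto
      have "(\<integral>u\<in>X -` S \<inter> space P. g (X u) \<partial>P)
          = (\<integral>u\<in>X -` S \<inter> space P. real_cond_exp P ?F (indicator A) u \<partial>P)"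
        unfolding set_lebesgue_integral_def
        by (rule integral_cong_AE) (use ae in auto)
      also have "\<dots> = measure P (A \<inter> (X -` S \<inter> space P))"
        using real_cond_exp_intA[OF int B] ind[OF B] by simp
      finally show ?thesis .
    qed
    ultimately show ?R by simp
  next
    assume R: ?R
    then have [measurable]: "g \<in> borel_measurable borel" by simp
    have "AE u in P. real_cond_exp P ?F (indicator A) u = g (X u)"
    proof (rule real_cond_exp_charact)
      fix B assume B: "B \<in> sets ?F"
      then obtain S where "S \<in> sets borel" "B = X -` S \<inter> space P" using setsF by auto
      then show "(\<integral>u\<in>B. indicator A u \<partial>P) = (\<integral>u\<in>B. g (X u) \<partial>P)"
        using R ind[OF B] by simp
    next
      show "(\<lambda>u. g (X u)) \<in> borel_measurable ?F"
        using XF by measurable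
    qed (use R int in auto)
    then show "g \<in> cond_prob_given P X A"
      by (auto simp: cond_prob_given_def)
  qed
qed

text \<open>Integrals and measures of preimages survive the change of variables along
  \<open>Z\<close>. A query whose event and image both factor through \<open>Z\<close> thus depends
  only on the law of \<open>Z\<close>.\<close>

lemma cond_prob_given_distr:
  fixes X :: "'b \<Rightarrow> 'c::topological_space"
  assumes P: "prob_space P" and Z [measurable]: "Z \<in> P \<rightarrow>\<^sub>M N"
    and X [measurable]: "X \<in> N \<rightarrow>\<^sub>M borel" and A [measurable]: "A \<in> sets N"
  shows "cond_prob_given P (\<lambda>u. X (Z u)) (Z -` A \<inter> space P) = cond_prob_given (distr P N Z) X A"
proof (rule set_eqI)
  fix g :: "'c \<Rightarrow> real"
  have P': "prob_space (distr P N Z)" by (rule prob_space.prob_space_distr[OF P Z])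
  have "(\<integral>u\<in>(\<lambda>u. X (Z u)) -` S \<inter> space P. g (X (Z u)) \<partial>P)
        = (\<integral>z\<in>X -` S \<inter> space (distr P N Z). g (X z) \<partial>distr P N Z)"
    if [measurable]: "S \<in> sets borel" "g \<in> borel_measurable borel" for S
    unfolding set_lebesgue_integral_def
  proof -
    have "(\<integral>z. indicator (X -` S \<inter> space N) z *\<^sub>R g (X z) \<partial>distr P N Z)
        = (\<integral>u. indicator (X -` S \<inter> space N) (Z u) *\<^sub>R g (X (Z u)) \<partial>P)"
      by (rule integral_distr) measurable
    also have "\<dots> = (\<integral>u. indicator ((\<lambda>u. X (Z u)) -` S \<inter> space P) u *\<^sub>R g (X (Z u)) \<partial>P)"
      by (intro Bochner_Integration.integral_cong)
        (auto simp: indicator_def measurable_space[OF Z])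
    finally show "(\<integral>u. indicator ((\<lambda>u. X (Z u)) -` S \<inter> space P) u *\<^sub>R g (X (Z u)) \<partial>P)
        = (\<integral>z. indicator (X -` S \<inter> space (distr P N Z)) z *\<^sub>R g (X z) \<partial>distr P N Z)"
      by simp
  qed
  moreover have "measure P ((Z -` A \<inter> space P) \<inter> ((\<lambda>u. X (Z u)) -` S \<inter> space P))
        = measure (distr P N Z) (A \<inter> (X -` S \<inter> space (distr P N Z)))"
    if [measurable]: "S \<in> sets borel" for S
    by (subst measure_distr[OF Z])
      (auto intro!: arg_cong[where f="measure P"] simp: measurable_space[OF Z])
  moreover have "integrable P (\<lambda>u. g (X (Z u))) \<longleftrightarrow> integrable (distr P N Z) (\<lambda>z. g (X z))"
    if [measurable]: "g \<in> borel_measurable borel"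
    by (subst integrable_distr_eq[OF Z]) auto
  ultimately show "g \<in> cond_prob_given P (\<lambda>u. X (Z u)) (Z -` A \<inter> space P) \<longleftrightarrow>
      g \<in> cond_prob_given (distr P N Z) X A"
    by (subst cond_prob_given_iff[OF P], measurable)
      (subst cond_prob_given_iff[OF P'], auto)
qed


section \<open>Sufficiency\<close>


lemma is_ascmD:
  assumes "is_ascm D DY M"
  shows "is_scm D (base M)" "prob_space (full_law M)"
    "image_fn M \<in> feature_space D (endo (base M)) \<Otimes>\<^sub>M exo_space (image_exo M) \<rightarrow>\<^sub>M borel"
    "label_fn M \<in> feature_space D (endo (base M)) \<Otimes>\<^sub>M borel \<rightarrow>\<^sub>M count_space DY"
    "sets (full_law M) = sets (exo_space (exo (base M) \<union> image_exo M))"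
    "distr (full_law M) (exo_space (exo (base M))) (\<lambda>u. restrict u (exo (base M)))
       = exo_law (base M)"
  using assms unfolding is_ascm_def by auto

lemma ascm_measurable:
  assumes M: "is_ascm D DY M"
  shows "features M \<in> full_law M \<rightarrow>\<^sub>M feature_space D (endo (base M))"
    "image_var M \<in> full_law M \<rightarrow>\<^sub>M borel"
    "label_var M \<in> full_law M \<rightarrow>\<^sub>M count_space DY"
proof -
  have [measurable_cong]: "sets (full_law M) = sets (exo_space (exo (base M) \<union> image_exo M))"
    by (rule is_ascmD(5)[OF M])
  have "scm_solution (base M)
      \<in> exo_space (exo (base M) \<union> image_exo M) \<rightarrow>\<^sub>M feature_space D (endo (base M))"
    by (rule scm_solution_measurable[OF is_ascmD(1)[OF M]]) simp
  then show f [measurable]: "features M \<in> full_law M \<rightarrow>\<^sub>M feature_space D (endo (base M))"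
    unfolding features_def by measurable
  have [measurable]: "(\<lambda>u. restrict u (image_exo M)) \<in> full_law M \<rightarrow>\<^sub>M exo_space (image_exo M)"
    unfolding measurable_cong_sets[OF is_ascmD(5)[OF M] refl]
    by (intro measurable_restrict_subset) auto
  note is_ascmD(3,4)[OF M, measurable]
  show g [measurable]: "image_var M \<in> full_law M \<rightarrow>\<^sub>M borel"
    unfolding image_var_def by measurable
  show "label_var M \<in> full_law M \<rightarrow>\<^sub>M count_space DY"
    unfolding label_var_def by measurable
qed

text \<open>The features read only the coordinates in \<open>exo (base M)\<close>, on which
  \<open>full_law M\<close> has the marginal \<open>exo_law (base M)\<close>. Positivity of the base
  model thereby passes to the augmented one.\<close>

lemma measure_features_eq:
  assumes M: "is_ascm D DY M" and fin: "finite (endo (base M))"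
    and D: "\<And>v. v \<in> endo (base M) \<Longrightarrow> countable (D v)"
    and B: "B \<subseteq> Pi\<^sub>E (endo (base M)) D"
  shows "measure (full_law M) (features M -` B \<inter> space (full_law M))
    = measure (scm_dist D (base M)) B"
proof -
  note N = is_ascmD(1)[OF M]
  have B': "B \<in> sets (feature_space D (endo (base M)))"
    using B sets_feature_space[OF fin, of D] D by auto
  have sol: "scm_solution (base M) \<in> exo_space (exo (base M)) \<rightarrow>\<^sub>M feature_space D (endo (base M))"
    by (rule scm_solution_measurable[OF N order_refl])
  have r: "(\<lambda>u. restrict u (exo (base M))) \<in> full_law M \<rightarrow>\<^sub>M exo_space (exo (base M))"
    unfolding measurable_cong_sets[OF is_ascmD(5)[OF M] refl]
    by (intro measurable_restrict_subset) auto
  have eq: "scm_solution (base M) (restrict u (exo (base M))) = features M u" for u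
  proof -
    have "restrict (restrict u (exo (base M))) (exo_args (base M) v)
        = restrict u (exo_args (base M) v)" if "v \<in> endo (base M)" for v
      using is_scmD(6)[OF N that] by (auto simp: restrict_def fun_eq_iff)
    then show ?thesis
      unfolding features_def using scm_solution_eq[OF N]
      by (intro scm_solution_eqI[OF N scm_solution_extensional[OF N]]) auto
  qed
  have "scm_dist D (base M) = distr (full_law M) (feature_space D (endo (base M))) (features M)"
    unfolding scm_dist_def is_ascmD(6)[OF M, symmetric]
    by (subst distr_distr[OF sol r]) (simp add: comp_def eq)
  then show ?thesis
    using measure_distr[OF ascm_measurable(1)[OF M] B'] by simp
qed

text \<open>Concepts in \<open>W\<close> are set to \<open>w\<close>; the remaining ones are
  non-descendants and keep their factual values. The right-hand side is therefore a function of the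
  factual features alone.\<close>

lemma label_var_do:
  assumes M: "is_ascm D DY M"
    and w: "w \<in> Pi\<^sub>E W D"
    and G: "scm_diagram (base M) = G"
    and h: "\<And>v x. v \<in> Pi\<^sub>E (verts G) D \<Longrightarrow> label_fn M (v, x) = h (restrict v T)"
    and T: "T \<subseteq> verts G" "T \<subseteq> W \<union> nondescendants G W"
  shows "label_var (ascm_do M W w) u
    = h (\<lambda>v\<in>T. if v \<in> W then w v else features M u v)"
proof -
  note N = is_ascmD(1)[OF M]
  have E: "endo (base M) = verts G" using G by (auto simp: scm_diagram_def)
  let ?x = "scm_solution (scm_do (base M) W w) u"
  have "?x \<in> Pi\<^sub>E (verts G) D"
    using scm_solution_in_PiE[OF is_scm_do[OF N w]] E by simp
  then have "label_var (ascm_do M W w) u = h (restrict ?x T)"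
    by (simp add: label_var_def features_def ascm_do_def h)
  also have "restrict ?x T = (\<lambda>v\<in>T. if v \<in> W then w v else features M u v)"
  proof
    fix v
    have "v \<in> nondescendants (scm_diagram (base M)) W" if "v \<in> T" "v \<notin> W"
      using T G that by auto
    then show "restrict ?x T v = (\<lambda>v\<in>T. if v \<in> W then w v else features M u v) v"
      using T E scm_solution_do_in[OF N w, of v u] scm_solution_do_nondescendant[OF N w, of v u]
      by (auto simp: features_def)
  qed
  finally show ?thesis .
qed

text \<open>The event "features equal \<open>x\<close>, label equals \<open>y\<close>" has the mass
  of \<open>x\<close> if the classifier maps \<open>x\<close> to \<open>y\<close>, and mass zero
  otherwise. As that mass is positive, the joint law reveals the classifier at
  \<open>x\<close>.\<close>

lemma joint_dist_determines_classifier: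
  fixes M1 M2 :: "('v, 'a, 'm::finite, 'y) ascm"
  assumes G: "finite (verts G)" "\<And>v. v \<in> verts G \<Longrightarrow> countable (D v)"
    and M: "M1 \<in> Omega D DY G" "M2 \<in> Omega D DY G"
    and J: "joint_dist D DY M1 = joint_dist D DY M2"
    and h1: "\<And>v x. v \<in> Pi\<^sub>E (verts G) D \<Longrightarrow> label_fn M1 (v, x) = h1 v"
    and h2: "\<And>v x. v \<in> Pi\<^sub>E (verts G) D \<Longrightarrow> label_fn M2 (v, x) = h2 v"
    and x: "x \<in> Pi\<^sub>E (verts G) D"
  shows "h1 x = h2 x"
proof (rule ccontr)
  assume ne: "h1 x \<noteq> h2 x"
  have x': "{x} \<in> sets (feature_space D (verts G))"
    using sets_feature_space[OF G(1), of D] G(2) x by auto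
  \<comment> \<open>Intersecting \<open>{y}\<close> with \<open>DY\<close> keeps the rectangle
    measurable for every \<open>y\<close>, whether or not it is a label.\<close>
  have joint: "measure (joint_dist D DY M) ({x} \<times> UNIV \<times> (DY \<inter> {y}))
      = (if h x = y then measure (scm_dist D (base M)) {x} else 0)"
    if M: "M \<in> Omega D DY G" and h: "\<And>v x. v \<in> Pi\<^sub>E (verts G) D \<Longrightarrow> label_fn M (v, x) = h v"
    for M :: "('v, 'a, 'm, 'y) ascm" and h y
  proof -
    have A: "is_ascm D DY M" and E: "endo (base M) = verts G"
      using M by (auto simp: Omega_def scm_diagram_def)
    note meas = ascm_measurable[OF A, unfolded E]
    have [measurable]: "features M \<in> full_law M \<rightarrow>\<^sub>M feature_space D (verts G)"
      "image_var M \<in> full_law M \<rightarrow>\<^sub>M borel" "label_var M \<in> full_law M \<rightarrow>\<^sub>M count_space DY"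
      using meas by auto
    have F: "features M u \<in> Pi\<^sub>E (verts G) D" for u
      using scm_solution_in_PiE[OF is_ascmD(1)[OF A]] E by (simp add: features_def)
    have L: "label_var M u = h (features M u)" for u
      by (simp add: label_var_def h F)
    have "(features M u, image_var M u, label_var M u) \<in> {x} \<times> UNIV \<times> (DY \<inter> {y})
       \<longleftrightarrow> features M u = x \<and> h x = y" if "u \<in> space (full_law M)" for u
      using measurable_space[OF meas(3) that] by (auto simp: L)
    then have "(\<lambda>u. (features M u, image_var M u, label_var M u)) -` ({x} \<times> UNIV \<times> (DY \<inter> {y}))
        \<inter> space (full_law M) = (if h x = y then features M -` {x} \<inter> space (full_law M) else {})"
      by auto
    moreover have "measure (joint_dist D DY M) ({x} \<times> UNIV \<times> (DY \<inter> {y}))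
        = measure (full_law M) ((\<lambda>u. (features M u, image_var M u, label_var M u)) -`
            ({x} \<times> UNIV \<times> (DY \<inter> {y})) \<inter> space (full_law M))"
      unfolding joint_dist_def E
      by (rule measure_distr) (use x' in \<open>auto intro!: pair_measureI\<close>)
    moreover have "measure (full_law M) (features M -` {x} \<inter> space (full_law M))
        = measure (scm_dist D (base M)) {x}"
      by (rule measure_features_eq[OF A]) (use x G E in auto)
    ultimately show ?thesis by simp
  qed
  have "measure (scm_dist D (base M1)) {x} > 0"
    using M(1) x by (auto simp: Omega_def positive_dist_def scm_diagram_def)
  then show False
    using joint[OF M(1) h1, of "h1 x"] joint[OF M(2) h2, of "h1 x"] J ne by simp
qed

lemma causally_interpretable_GCP:
  fixes G :: "'v diagram" and D :: "'v \<Rightarrow> 'a set" and DY :: "'y set"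
  assumes G: "finite (verts G)" "\<And>v. v \<in> verts G \<Longrightarrow> countable (D v) \<and> D v \<noteq> {}"
    and T: "T \<subseteq> verts G" "T \<subseteq> W \<union> nondescendants G W"
  shows "causally_interpretable D DY (Omega_GCP D DY G T :: ('v, 'a, 'm::finite, 'y) ascm set)
    (query D DY W)"
  unfolding causally_interpretable_def
proof (intro ballI impI)
  fix M1 M2 :: "('v, 'a, 'm, 'y) ascm"
  assume M: "M1 \<in> Omega_GCP D DY G T" "M2 \<in> Omega_GCP D DY G T"
    and J: "joint_dist D DY M1 = joint_dist D DY M2"
  obtain h1 where h1: "h1 \<in> Pi\<^sub>E T D \<rightarrow> DY"
      "\<And>v x. v \<in> Pi\<^sub>E (verts G) D \<Longrightarrow> label_fn M1 (v, x) = h1 (restrict v T)"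
    using M(1) by (auto simp: Omega_GCP_def)
  obtain h2 where h2: "h2 \<in> Pi\<^sub>E T D \<rightarrow> DY"
      "\<And>v x. v \<in> Pi\<^sub>E (verts G) D \<Longrightarrow> label_fn M2 (v, x) = h2 (restrict v T)"
    using M(2) by (auto simp: Omega_GCP_def)
  have \<Omega>: "M1 \<in> Omega D DY G" "M2 \<in> Omega D DY G"
    using M by (auto simp: Omega_GCP_def)
  have h_eq: "h1 r = h2 r" if r: "r \<in> Pi\<^sub>E T D" for r
  proof -
    \<comment> \<open>A partial assignment on \<open>T\<close> is extended by arbitrary domain
      elements, since classifiers are compared at full assignments.\<close>
    define x where "x = (\<lambda>v\<in>verts G. if v \<in> T then r v else SOME a. a \<in> D v)"
    have x: "x \<in> Pi\<^sub>E (verts G) D"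
      using r G(2) by (auto simp: x_def some_in_eq)
    have "restrict x T = r"
    proof (rule extensionalityI[of _ T])
      show "r \<in> extensional T" using r by (simp add: PiE_iff)
    qed (use T in \<open>auto simp: x_def\<close>)
    then show ?thesis
      using joint_dist_determines_classifier[OF G(1) _ \<Omega> J, of "\<lambda>v. h1 (restrict v T)"
        "\<lambda>v. h2 (restrict v T)" x] G(2) h1(2) h2(2) x by simp
  qed
  let ?N = "feature_space D (verts G) \<Otimes>\<^sub>M (borel :: (real^'m) measure) \<Otimes>\<^sub>M count_space DY"
  \<comment> \<open>The right-hand side mentions the model only through its joint law; the
    classifier is \<open>h1\<close> for either model.\<close>
  have query: "cond_prob_given (full_law M) (image_var M)
          {u \<in> space (full_law M). label_var (ascm_do M W w) u = y}
      = cond_prob_given (joint_dist D DY M) (fst \<circ> snd)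
          ({x \<in> Pi\<^sub>E (verts G) D. h1 (\<lambda>v\<in>T. if v \<in> W then w v else x v) = y} \<times> UNIV \<times> DY)"
    if M: "M \<in> Omega D DY G"
      and h: "\<And>v x. v \<in> Pi\<^sub>E (verts G) D \<Longrightarrow> label_fn M (v, x) = h1 (restrict v T)"
      and w: "w \<in> Pi\<^sub>E W D" for M :: "('v, 'a, 'm, 'y) ascm" and w y
  proof -
    let ?Z = "\<lambda>u. (features M u, image_var M u, label_var M u)"
    let ?B = "{x \<in> Pi\<^sub>E (verts G) D. h1 (\<lambda>v\<in>T. if v \<in> W then w v else x v) = y}"
    have A: "is_ascm D DY M" and E: "endo (base M) = verts G" and G': "scm_diagram (base M) = G"
      using M by (auto simp: Omega_def scm_diagram_def)
    have [measurable]: "features M \<in> full_law M \<rightarrow>\<^sub>M feature_space D (verts G)"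
      "image_var M \<in> full_law M \<rightarrow>\<^sub>M borel" "label_var M \<in> full_law M \<rightarrow>\<^sub>M count_space DY"
      using ascm_measurable[OF A, unfolded E] by auto
    have F: "features M u \<in> Pi\<^sub>E (verts G) D" for u
      using scm_solution_in_PiE[OF is_ascmD(1)[OF A]] E by (simp add: features_def)
    have "{u \<in> space (full_law M). label_var (ascm_do M W w) u = y}
        = ?Z -` (?B \<times> UNIV \<times> DY) \<inter> space (full_law M)"
      using F measurable_space[OF ascm_measurable(3)[OF A]]
      by (auto simp: label_var_do[OF A w G', of h1 T, OF h T])
    moreover have "?B \<in> sets (feature_space D (verts G))"
      using sets_feature_space[OF G(1), of D] G(2) by auto
    then have "?B \<times> UNIV \<times> DY \<in> sets ?N"
      by (intro pair_measureI) auto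
    moreover have "?Z \<in> full_law M \<rightarrow>\<^sub>M ?N" by measurable
    ultimately show ?thesis
      using cond_prob_given_distr[OF is_ascmD(2)[OF A], of ?Z ?N "fst \<circ> snd" "?B \<times> UNIV \<times> DY"]
      by (simp add: joint_dist_def E)
  qed
  \<comment> \<open>With the classifiers identified on \<open>T\<close>, the formula for the query
    also applies to \<open>M2\<close> with \<open>h1\<close>.\<close>
  have "label_fn M2 (v, x) = h1 (restrict v T)" if "v \<in> Pi\<^sub>E (verts G) D" for v x
    using h2(2)[OF that] h_eq[of "restrict v T"] that T by fastforce
  then show "query D DY W M1 = query D DY W M2"
    unfolding query_def using query[OF \<Omega>(1) h1(2)] query[OF \<Omega>(2)] J
    by (intro restrict_ext) simp
qed

section \<open>Necessity\<close>

lemma measurable_feature_space: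
  assumes "finite S" "\<And>v. v \<in> S \<Longrightarrow> countable (D v)" "f \<in> Pi\<^sub>E S D \<rightarrow> space M"
  shows "f \<in> feature_space D S \<rightarrow>\<^sub>M M"
proof -
  have "sets (feature_space D S) = sets (count_space (Pi\<^sub>E S D))"
    using sets_feature_space[OF assms(1), of D] assms(2) by simp
  then have "feature_space D S \<rightarrow>\<^sub>M M = count_space (Pi\<^sub>E S D) \<rightarrow>\<^sub>M M"
    by (rule measurable_cong_sets) simp
  then show ?thesis
    using assms(3) by simp
qed

text \<open>An event determined by \<open>X\<close> is its own conditional expectation. This gives
  an explicit version of the query in the model without flips.\<close>

lemma indicator_in_cond_prob_given:
  assumes P: "prob_space P" and X: "X \<in> P \<rightarrow>\<^sub>M borel" and C: "C \<in> sets borel"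
  shows "indicator C \<in> cond_prob_given P X (X -` C \<inter> space P)"
proof -
  interpret prob_space P by fact
  let ?A = "X -` C \<inter> space P"
  have A: "?A \<in> sets P" using X C by measurable
  have "integrable P (\<lambda>u. indicator C (X u) :: real)"
    using X C by (intro integrable_const_bound[of _ 1]) (auto simp: indicator_def)
  moreover have "(\<integral>u\<in>X -` S \<inter> space P. indicator C (X u) \<partial>P) = measure P (?A \<inter> (X -` S \<inter> space P))"
    if S: "S \<in> sets borel" for S
  proof -
    have "?A \<inter> (X -` S \<inter> space P) \<in> sets P"
      by (rule sets.Int[OF A measurable_sets[OF X S]])
    moreover have "(\<integral>u\<in>X -` S \<inter> space P. indicator C (X u) \<partial>P)
        = integral\<^sup>L P (indicator (?A \<inter> (X -` S \<inter> space P)) :: _ \<Rightarrow> real)"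
      unfolding set_lebesgue_integral_def
      by (intro Bochner_Integration.integral_cong) (auto simp: indicator_def)
    ultimately show ?thesis
      by (simp add: sets.Int_space_eq2 del: sets.Int)
  qed
  ultimately show ?thesis
    using C by (subst cond_prob_given_iff[OF P X A]) auto
qed

section \<open>Construction of the pair of models that refutes interpretability\<close>

locale flip_models =
  fixes G :: "'v diagram" and D :: "'v \<Rightarrow> 'a set" and a b :: "'v \<Rightarrow> 'a"
  assumes G: "causal_diagram G"
    and countable_D: "v \<in> verts G \<Longrightarrow> countable (D v)"
    and ab: "v \<in> verts G \<Longrightarrow> a v \<in> D v \<and> b v \<in> D v \<and> a v \<noteq> b v"
begin

lemma fin: "finite (verts G)"
  and dirG: "directed G \<subseteq> verts G \<times> verts G" "acyclic (directed G)"
  and bidG: "bidirected G \<subseteq> verts G \<times> verts G" "sym (bidirected G)" "irrefl (bidirected G)"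
  using G by (auto simp: causal_diagram_def)

text \<open>
  The exogenous variable of a pair of equal vertices is the private noise of that vertex; those of
  bidirected pairs are arguments of both mechanisms, which ignore them.
\<close>

definition slot :: "'v \<Rightarrow> 'v \<Rightarrow> nat" where
  "slot i j = prod_encode (to_nat_on (verts G) i, to_nat_on (verts G) j)"

definition slot_pairs :: "('v \<times> 'v) set" where
  "slot_pairs = Id_on (verts G) \<union> bidirected G"

definition slots :: "nat set" where
  "slots = (\<lambda>(i, j). slot i j) ` slot_pairs"

definition slot_args :: "'v \<Rightarrow> nat set" where
  "slot_args v = (\<lambda>(i, j). slot i j) ` {(i, j) \<in> slot_pairs. i = v \<or> j = v}"

text \<open>The geometric law, pushed through an enumeration of \<open>D v\<close>, gives every
  value positive mass. The fair coin mixes it with its swapped copy, which makes the result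
  invariant under the swap.\<close>

definition noise :: "'v \<Rightarrow> 'a pmf" where
  "noise v = map_pmf (\<lambda>(z, c). if c then z else Transposition.transpose (a v) (b v) z)
     (pair_pmf (map_pmf (from_nat_into (D v)) (geometric_pmf (1/2))) (bernoulli_pmf (1/2)))"

definition decode :: "'v \<Rightarrow> real \<Rightarrow> 'a" where
  "decode v r = from_nat_into (D v) (nat \<lfloor>r\<rfloor>)"

text \<open>The inverse recovers the vertex from its private slot. At a shared slot it is
  unspecified, and the outcome is still a probability law.\<close>

definition slot_law :: "nat \<Rightarrow> real measure" where
  "slot_law k = (let v = inv_into (verts G) (\<lambda>v. slot v v) k in
     distr (measure_pmf (noise v)) borel (\<lambda>z. real (to_nat_on (D v) z)))"

text \<open>For fixed parent values this is an involution on the values of \<open>v\<close>, so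
  noise can be recovered from features. With \<open>R\<close> empty it is the identity, which gives
  the model of independent noise.\<close>

definition flip :: "'v set \<Rightarrow> ('v \<Rightarrow> 'v) \<Rightarrow> 'v \<Rightarrow> ('v \<Rightarrow> 'a) \<Rightarrow> 'a \<Rightarrow> 'a" where
  "flip R pre v x =
     (if v \<in> R \<and> x (pre v) = b (pre v) then Transposition.transpose (a v) (b v) else id)"

definition selects_parents :: "'v set \<Rightarrow> ('v \<Rightarrow> 'v) \<Rightarrow> bool" where
  "selects_parents R pre \<longleftrightarrow> (\<forall>v\<in>R. (pre v, v) \<in> directed G)"

text \<open>All graph parents are declared as arguments, although at most \<open>pre v\<close>
  affects the value: edges of the diagram record declared arguments, so every \<open>R\<close>
  yields the same diagram.\<close>

definition flip_scm :: "'v set \<Rightarrow> ('v \<Rightarrow> 'v) \<Rightarrow> ('v, 'a) scm" where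
  "flip_scm R pre =
     \<lparr>exo = slots, endo = verts G, parents = (\<lambda>v. {p. (p, v) \<in> directed G}),
      exo_args = slot_args,
      mech = (\<lambda>v (x, u). flip R pre v x (decode v (u (slot v v)))),
      exo_law = Pi\<^sub>M slots slot_law\<rparr>"

lemma flip_scm_simps [simp]:
  "exo (flip_scm R pre) = slots" "endo (flip_scm R pre) = verts G"
  "parents (flip_scm R pre) v = {p. (p, v) \<in> directed G}"
  "exo_args (flip_scm R pre) = slot_args"
  "mech (flip_scm R pre) v (x, u) = flip R pre v x (decode v (u (slot v v)))"
  "exo_law (flip_scm R pre) = Pi\<^sub>M slots slot_law"
  by (simp_all add: flip_scm_def)

section \<open>Slots and bidirected edges\<close>

lemma slot_eq_iff:
  assumes "i \<in> verts G" "j \<in> verts G" "k \<in> verts G" "l \<in> verts G"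
  shows "slot i j = slot k l \<longleftrightarrow> i = k \<and> j = l"
  using assms countable_finite[OF fin] by (auto simp: slot_def)

lemma slot_pairs_verts: "slot_pairs \<subseteq> verts G \<times> verts G"
  using bidG by (auto simp: slot_pairs_def)

lemma slots_finite: "finite slots"
  using slot_pairs_verts fin unfolding slots_def by (meson finite_SigmaI finite_imageI finite_subset)

lemma slot_args_subset: "slot_args v \<subseteq> slots"
  by (auto simp: slot_args_def slots_def)

lemma private_slot: "v \<in> verts G \<Longrightarrow> slot v v \<in> slot_args v"
  by (force simp: slot_args_def slot_pairs_def)

text \<open>The coding of pairs is injective, so a slot common to two distinct vertices comes from a
  single pair containing both, hence from a bidirected edge in one of its orientations.\<close>

lemma slot_args_disjoint_iff:
  assumes "i \<in> verts G" "j \<in> verts G" "i \<noteq> j"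
  shows "slot_args i \<inter> slot_args j = {} \<longleftrightarrow> (i, j) \<notin> bidirected G"
proof
  assume dis: "slot_args i \<inter> slot_args j = {}"
  show "(i, j) \<notin> bidirected G"
  proof
    assume "(i, j) \<in> bidirected G"
    then have "slot i j \<in> slot_args i \<inter> slot_args j"
      by (force simp: slot_args_def slot_pairs_def)
    then show False using dis by blast
  qed
next
  assume n: "(i, j) \<notin> bidirected G"
  show "slot_args i \<inter> slot_args j = {}"
  proof (rule ccontr)
    assume "slot_args i \<inter> slot_args j \<noteq> {}"
    then obtain p q p' q' where
      1: "(p, q) \<in> slot_pairs" "p = i \<or> q = i" "(p', q') \<in> slot_pairs" "p' = j \<or> q' = j"
        "slot p q = slot p' q'"
      by (auto simp: slot_args_def)
    then have "p = p'" "q = q'"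
      using slot_eq_iff slot_pairs_verts by blast+
    then show False
      using 1 n assms(3) symD[OF bidG(2)] by (auto simp: slot_pairs_def)
  qed
qed

section \<open>Private noise and its law\<close>

lemma decode_measurable: "v \<in> verts G \<Longrightarrow> decode v \<in> borel \<rightarrow>\<^sub>M count_space (D v)"
proof -
  assume v: "v \<in> verts G"
  have "(\<lambda>r::real. nat \<lfloor>r\<rfloor>) \<in> borel \<rightarrow>\<^sub>M count_space UNIV" by measurable
  moreover have "from_nat_into (D v) \<in> count_space UNIV \<rightarrow>\<^sub>M count_space (D v)"
    using ab[OF v] by (auto intro: from_nat_into)
  ultimately show ?thesis
    unfolding decode_def by (rule measurable_compose)
qed

lemma transpose_in: "v \<in> verts G \<Longrightarrow> z \<in> D v \<Longrightarrow> Transposition.transpose (a v) (b v) z \<in> D v"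
  using ab[of v] by (auto simp: Transposition.transpose_def)

lemma flip_in: "v \<in> verts G \<Longrightarrow> z \<in> D v \<Longrightarrow> flip R pre v x z \<in> D v"
  using transpose_in by (auto simp: flip_def)

lemma flip_flip [simp]: "flip R pre v x (flip R pre v x z) = z"
  by (simp add: flip_def)

text \<open>Applying the swap exchanges the two branches of the mixture, which amounts to negating
  the fair coin, and the coin is invariant under negation.\<close>

lemma noise_transpose: "map_pmf (Transposition.transpose (a v) (b v)) (noise v) = noise v"
proof -
  let ?B = "bernoulli_pmf (1/2)"
  have B: "map_pmf Not ?B = ?B"
  proof (rule pmf_eqI)
    fix c
    have "pmf (map_pmf Not ?B) (Not (Not c)) = pmf ?B (Not c)"
      by (rule pmf_map_inj') (auto intro: injI)
    then show "pmf (map_pmf Not ?B) c = pmf ?B c" by (cases c) simp_all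
  qed
  let ?q = "map_pmf (from_nat_into (D v)) (geometric_pmf (1/2))"
  have "noise v = map_pmf (\<lambda>(z, c). if c then z else Transposition.transpose (a v) (b v) z)
      (pair_pmf (map_pmf id ?q) (map_pmf Not ?B))"
    unfolding noise_def B by simp
  also have "\<dots> = map_pmf (Transposition.transpose (a v) (b v)) (noise v)"
    unfolding pair_map_pmf1 pair_map_pmf2 noise_def
    by (simp add: map_pmf_comp case_prod_unfold if_distrib) (auto intro!: map_pmf_cong)
  finally show ?thesis ..
qed

text \<open>This invariance is what makes flips invisible in the observational law.\<close>

lemma pmf_noise_flip: "pmf (noise v) (flip R pre v x z) = pmf (noise v) z"
proof -
  have "pmf (map_pmf (Transposition.transpose (a v) (b v)) (noise v)) (Transposition.transpose (a v) (b v) z) = pmf (noise v) z"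
    by (rule pmf_map_inj') (rule inj_transpose)
  then show ?thesis by (simp add: flip_def noise_transpose)
qed

lemma set_noise:
  assumes "v \<in> verts G"
  shows "set_pmf (noise v) = D v"
proof -
  have "D v \<noteq> {}" using ab[OF assms] by auto
  then have "set_pmf (map_pmf (from_nat_into (D v)) (geometric_pmf (1/2))) = D v"
    using range_from_nat_into[OF _ countable_D[OF assms]] by (simp add: set_pmf_geometric)
  then have "set_pmf (noise v)
      = (\<lambda>(z, c). if c then z else Transposition.transpose (a v) (b v) z) ` (D v \<times> UNIV)"
    by (simp add: noise_def set_pmf_bernoulli)
  also have "\<dots> = D v"
    using transpose_in[OF assms] by (force split: if_splits)
  finally show ?thesis .
qed

lemma prob_space_slot_law: "prob_space (slot_law k)"
  unfolding slot_law_def Let_def by (rule measure_pmf.prob_space_distr) simp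

lemma sets_slot_law [simp, measurable_cong]: "sets (slot_law k) = sets borel"
  by (simp add: slot_law_def Let_def)

lemma sets_exo_law: "sets (Pi\<^sub>M S slot_law) = sets (exo_space S)"
  by (rule sets_PiM_cong) auto

lemma prob_space_exo_law: "prob_space (Pi\<^sub>M slots slot_law)"
  by (rule prob_space_PiM) (rule prob_space_slot_law)

lemma measure_decode:
  assumes v: "v \<in> verts G" and z: "z \<in> D v"
  shows "measure (slot_law (slot v v)) (decode v -` {z}) = pmf (noise v) z"
proof -
  have "inv_into (verts G) (\<lambda>v. slot v v) (slot v v) = v"
    by (rule inv_into_f_f[OF _ v]) (auto simp: inj_on_def slot_eq_iff)
  then have "measure (slot_law (slot v v)) (decode v -` {z})
      = measure (distr (measure_pmf (noise v)) borel (\<lambda>z. real (to_nat_on (D v) z))) (decode v -` {z})"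
    by (simp add: slot_law_def)
  also have "\<dots> = measure (measure_pmf (noise v))
      ((\<lambda>z. real (to_nat_on (D v) z)) -` (decode v -` {z}))"
    using measurable_sets[OF decode_measurable[OF v], of "{z}"] z by (subst measure_distr) auto
  \<comment> \<open>Decoding inverts \<open>to_nat_on (D v)\<close> only on \<open>D v\<close>, so
    the two events agree almost surely, the noise being supported there.\<close>
  also have "\<dots> = measure (measure_pmf (noise v)) {z}"
    using set_noise[OF v] countable_D[OF v] z
    by (intro measure_pmf.finite_measure_eq_AE) (auto simp: AE_measure_pmf_iff decode_def)
  finally show ?thesis by (simp add: pmf.rep_eq)
qed

text \<open>Distinct vertices have distinct private slots, and the coordinates of the product
  measure are independent. The map \<open>?i\<close> translates slots back to vertices.\<close>

lemma measure_noise_vector: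
  assumes z: "\<And>v. v \<in> verts G \<Longrightarrow> z v \<in> D v"
  shows "measure (Pi\<^sub>M slots slot_law)
      {u \<in> space (Pi\<^sub>M slots slot_law). \<forall>v\<in>verts G. decode v (u (slot v v)) = z v}
    = (\<Prod>v\<in>verts G. pmf (noise v) (z v))"
proof -
  interpret product_prob_space slot_law slots
    by (intro product_prob_spaceI prob_space_slot_law)
  let ?s = "\<lambda>v. slot v v"
  let ?i = "inv_into (verts G) ?s"
  have inj: "inj_on ?s (verts G)" by (auto simp: inj_on_def slot_eq_iff)
  have J: "?s ` verts G \<subseteq> slots" using private_slot slot_args_subset by blast
  have mb: "decode v -` {z v} \<in> sets borel" if "v \<in> verts G" for v
    using measurable_sets[OF decode_measurable[OF that], of "{z v}"] z[OF that] by auto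
  have "emeasure (Pi\<^sub>M slots slot_law)
      {u \<in> space (Pi\<^sub>M slots slot_law). \<forall>k\<in>?s ` verts G. u k \<in> decode (?i k) -` {z (?i k)}}
    = (\<Prod>k\<in>?s ` verts G. emeasure (slot_law k) (decode (?i k) -` {z (?i k)}))"
    by (rule emeasure_PiM_Collect[OF J]) (use fin mb in \<open>auto simp: inv_into_f_f[OF inj]\<close>)
  also have "\<dots> = (\<Prod>v\<in>verts G. emeasure (slot_law (slot v v)) (decode v -` {z v}))"
    by (subst prod.reindex[OF inj]) (auto intro!: prod.cong simp: inv_into_f_f[OF inj])
  also have "\<dots> = (\<Prod>v\<in>verts G. ennreal (pmf (noise v) (z v)))"
    using measure_decode[OF _ z]
    by (intro prod.cong) (auto simp: finite_measure.emeasure_eq_measure[OF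
        prob_space.finite_measure[OF prob_space_slot_law]])
  also have "{u \<in> space (Pi\<^sub>M slots slot_law). \<forall>k\<in>?s ` verts G. u k \<in> decode (?i k) -` {z (?i k)}}
    = {u \<in> space (Pi\<^sub>M slots slot_law). \<forall>v\<in>verts G. decode v (u (slot v v)) = z v}"
    by (auto simp: inv_into_f_f[OF inj])
  finally show ?thesis
    by (simp add: measure_def prod_ennreal prod_nonneg)
qed

section \<open>Independence of noise and the induced diagram\<close>

lemma indep_slot_args:
  assumes "slot_args i \<inter> slot_args j = {}"
    and i: "i \<in> verts G"
  shows "prob_space.indep_var (Pi\<^sub>M slots slot_law)
     (exo_space (slot_args i)) (\<lambda>u. restrict u (slot_args i))
     (exo_space (slot_args j)) (\<lambda>u. restrict u (slot_args j))"
proof -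
  interpret prob_space "Pi\<^sub>M slots slot_law" by (rule prob_space_exo_law)
  \<comment> \<open>The product criterion for independence asks for a nonempty index set; the
    private slot of \<open>i\<close> provides an element.\<close>
  have nonempty: "slots \<noteq> {}"
    using private_slot[OF i] slot_args_subset by blast
  have "indep_vars (\<lambda>_. borel) (\<lambda>k u. u k) slots"
  proof (subst indep_vars_iff_distr_eq_PiM'[OF nonempty])
    show "(\<lambda>u. u k) \<in> Pi\<^sub>M slots slot_law \<rightarrow>\<^sub>M borel" if "k \<in> slots" for k
      using measurable_component_singleton[OF that, of slot_law]
      by (simp add: measurable_cong_sets[OF refl sets_slot_law])
    have "distr (Pi\<^sub>M slots slot_law) (exo_space slots) (\<lambda>u. \<lambda>k\<in>slots. u k)
        = distr (Pi\<^sub>M slots slot_law) (Pi\<^sub>M slots slot_law) (\<lambda>u. u)"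
      by (rule distr_cong) (auto simp: sets_exo_law space_PiM PiE_iff extensional_restrict)
    moreover have "distr (Pi\<^sub>M slots slot_law) borel (\<lambda>u. u k) = slot_law k" if "k \<in> slots" for k
    proof -
      have "distr (Pi\<^sub>M slots slot_law) borel (\<lambda>u. u k)
          = distr (Pi\<^sub>M slots slot_law) (slot_law k) (\<lambda>u. u k)"
        by (rule distr_cong) auto
      then show ?thesis
        using distr_PiM_component[of slots slot_law k] that slots_finite prob_space_slot_law by simp
    qed
    ultimately show "distr (Pi\<^sub>M slots slot_law) (exo_space slots) (\<lambda>u. \<lambda>k\<in>slots. u k)
        = Pi\<^sub>M slots (\<lambda>k. distr (Pi\<^sub>M slots slot_law) borel (\<lambda>u. u k))"
      by (simp add: distr_id2 cong: PiM_cong)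
  qed
  then show ?thesis
    by (rule indep_var_restrict[OF _ assms(1) slot_args_subset slot_args_subset])
qed

lemma flip_mech_measurable:
  assumes v: "v \<in> verts G" and pre: "selects_parents R pre"
  shows "mech (flip_scm R pre) v \<in> feature_space D {p. (p, v) \<in> directed G}
    \<Otimes>\<^sub>M exo_space (slot_args v) \<rightarrow>\<^sub>M count_space (D v)"
    (is "_ \<in> ?M \<rightarrow>\<^sub>M _")
proof -
  have "(\<lambda>y. decode v (snd y (slot v v))) \<in> ?M \<rightarrow>\<^sub>M count_space (D v)"
    by (rule measurable_compose[OF _ decode_measurable[OF v]])
      (rule measurable_compose[OF measurable_snd measurable_component_singleton[OF private_slot[OF v]]])
  note dec = this
  have "Transposition.transpose (a v) (b v) \<in> count_space (D v) \<rightarrow>\<^sub>M count_space (D v)"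
    using transpose_in[OF v] by auto
  note tr = measurable_compose[OF dec this]
  show ?thesis
  proof (cases "v \<in> R")
    case True
    have "(\<lambda>y. fst y (pre v)) \<in> ?M \<rightarrow>\<^sub>M count_space (D (pre v))"
      by (rule measurable_compose[OF measurable_fst measurable_component_singleton])
        (use pre True in \<open>auto simp: selects_parents_def\<close>)
    from measurable_compose[OF this, of "\<lambda>z. z = b (pre v)" "count_space UNIV"]
    have "Measurable.pred ?M (\<lambda>y. fst y (pre v) = b (pre v))" by simp
    then have "(\<lambda>y. if fst y (pre v) = b (pre v) then Transposition.transpose (a v) (b v) (decode v (snd y (slot v v)))
        else decode v (snd y (slot v v))) \<in> ?M \<rightarrow>\<^sub>M count_space (D v)"
      using tr dec by (intro measurable_If) (auto simp: pred_def)
    moreover have "mech (flip_scm R pre) v = (\<lambda>y. if fst y (pre v) = b (pre v)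
        then Transposition.transpose (a v) (b v) (decode v (snd y (slot v v))) else decode v (snd y (slot v v)))"
      using True by (auto simp: flip_scm_def flip_def fun_eq_iff)
    ultimately show ?thesis by simp
  next
    case False
    then have "mech (flip_scm R pre) v = (\<lambda>y. decode v (snd y (slot v v)))"
      by (auto simp: flip_scm_def flip_def fun_eq_iff)
    then show ?thesis using dec by simp
  qed
qed

lemma scm_directed_flip: "scm_directed (flip_scm R pre) = directed G"
  using dirG(1) by (auto simp: scm_directed_def)

lemma is_scm_flip:
  assumes pre: "selects_parents R pre"
  shows "is_scm D (flip_scm R pre)"
proof -
  have "{p. (p, v) \<in> directed G} \<subseteq> verts G - {v}" for v
    using dirG by (auto simp: acyclic_def)
  then show ?thesis
    unfolding is_scm_def scm_directed_flip
    using fin dirG(2) slot_args_subset flip_mech_measurable[OF _ pre] prob_space_exo_law sets_exo_law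
    by simp
qed

text \<open>Disjoint argument sets are independent under the product law, so dependence adds no
  bidirected edge beyond those due to shared slots.\<close>

lemma scm_diagram_flip: "scm_diagram (flip_scm R pre) = G"
proof -
  have "scm_bidirected (flip_scm R pre) = bidirected G"
  proof -
    have "(i, j) \<in> scm_bidirected (flip_scm R pre) \<longleftrightarrow>
        i \<in> verts G \<and> j \<in> verts G \<and> i \<noteq> j \<and> slot_args i \<inter> slot_args j \<noteq> {}" for i j
      using indep_slot_args[of i j] by (auto simp: scm_bidirected_def)
    moreover have "i \<in> verts G \<and> j \<in> verts G \<and> i \<noteq> j" if "(i, j) \<in> bidirected G" for i j
      using that bidG(1,3) by (auto simp: irrefl_def)
    ultimately have "(i, j) \<in> scm_bidirected (flip_scm R pre) \<longleftrightarrow> (i, j) \<in> bidirected G" for i j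
      using slot_args_disjoint_iff[of i j] by blast
    then show ?thesis by auto
  qed
  then show ?thesis
    by (simp add: scm_diagram_def scm_directed_flip)
qed

section \<open>Observational law of the flip models\<close>

text \<open>Because each flip is an involution given the parents, the structural equations can be
  solved for the noise: a feature vector determines the private noise of every vertex.\<close>

lemma flip_solution_iff:
  assumes pre: "selects_parents R pre" and x: "x \<in> Pi\<^sub>E (verts G) D"
  shows "scm_solution (flip_scm R pre) u = x \<longleftrightarrow>
    (\<forall>v\<in>verts G. decode v (u (slot v v)) = flip R pre v x (x v))"
proof -
  note N = is_scm_flip[OF pre]
  \<comment> \<open>The selected vertex \<open>pre v\<close> is a parent of \<open>v\<close>, so
    restricting to the parents loses nothing.\<close>
  have loc: "flip R pre v (restrict y {p. (p, v) \<in> directed G}) = flip R pre v y" for v y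
    using pre by (auto simp: flip_def selects_parents_def)
  have mech: "mech (flip_scm R pre) v
      (restrict y (parents (flip_scm R pre) v), restrict u (exo_args (flip_scm R pre) v))
    = flip R pre v y (decode v (u (slot v v)))" if "v \<in> verts G" for v y
    using private_slot[OF that] by (simp add: loc)
  show ?thesis
  proof
    assume "scm_solution (flip_scm R pre) u = x"
    then have "x v = flip R pre v x (decode v (u (slot v v)))" if "v \<in> verts G" for v
      using scm_solution_eq[OF N, of v u] mech[OF that, of x] that by simp
    then show "\<forall>v\<in>verts G. decode v (u (slot v v)) = flip R pre v x (x v)"
      by (metis flip_flip)
  next
    assume eq: "\<forall>v\<in>verts G. decode v (u (slot v v)) = flip R pre v x (x v)"
    show "scm_solution (flip_scm R pre) u = x"
    proof (rule scm_solution_eqI[OF N])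
      fix v assume "v \<in> endo (flip_scm R pre)"
      then show "x v = mech (flip_scm R pre) v
          (restrict x (parents (flip_scm R pre) v), restrict u (exo_args (flip_scm R pre) v))"
        using mech[of v x] eq by simp
    qed (use x in \<open>simp add: PiE_iff\<close>)
  qed
qed

text \<open>The features equal \<open>x\<close> exactly when the private noises form the flipped
  vector. Its product mass equals that of \<open>x\<close> by swap invariance, so the result does
  not involve \<open>R\<close>.\<close>

lemma measure_flip_scm_dist:
  assumes pre: "selects_parents R pre" and x: "x \<in> Pi\<^sub>E (verts G) D"
  shows "measure (scm_dist D (flip_scm R pre)) {x} = (\<Prod>v\<in>verts G. pmf (noise v) (x v))"
proof -
  note N = is_scm_flip[OF pre]
  have x': "{x} \<in> sets (feature_space D (verts G))"
    using sets_feature_space[OF fin, of D] countable_D x by auto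
  have "scm_solution (flip_scm R pre) \<in> Pi\<^sub>M slots slot_law \<rightarrow>\<^sub>M feature_space D (verts G)"
    using scm_solution_measurable[OF N order_refl]
    by (simp add: measurable_cong_sets[OF sets_exo_law refl])
  then have "measure (scm_dist D (flip_scm R pre)) {x} = measure (Pi\<^sub>M slots slot_law)
      (scm_solution (flip_scm R pre) -` {x} \<inter> space (Pi\<^sub>M slots slot_law))"
    using x' by (simp add: scm_dist_def measure_distr)
  also have "scm_solution (flip_scm R pre) -` {x} \<inter> space (Pi\<^sub>M slots slot_law)
      = {u \<in> space (Pi\<^sub>M slots slot_law).
          \<forall>v\<in>verts G. decode v (u (slot v v)) = flip R pre v x (x v)}"
    using flip_solution_iff[OF pre x] by auto
  also have "measure (Pi\<^sub>M slots slot_law) \<dots> = (\<Prod>v\<in>verts G. pmf (noise v) (flip R pre v x (x v)))"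
    by (rule measure_noise_vector) (use x in \<open>auto intro: flip_in\<close>)
  finally show ?thesis by (simp add: pmf_noise_flip)
qed

lemma positive_flip_scm_dist:
  assumes pre: "selects_parents R pre" and x: "x \<in> Pi\<^sub>E (verts G) D"
  shows "measure (scm_dist D (flip_scm R pre)) {x} > 0"
  unfolding measure_flip_scm_dist[OF assms]
  using x by (intro prod_pos pmf_positive) (auto simp: set_noise)

text \<open>A law on a countable discrete space is determined by its point masses, which were
  computed independently of \<open>R\<close>.\<close>

lemma flip_scm_dist_eq:
  assumes pre: "selects_parents R pre"
  shows "scm_dist D (flip_scm R pre) = scm_dist D (flip_scm {} pre)"
proof -
  have sets: "sets (scm_dist D (flip_scm R pre)) = Pow (Pi\<^sub>E (verts G) D)" for R
    using sets_feature_space[OF fin, of D] countable_D by (simp add: scm_dist_def)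
  have P: "prob_space (scm_dist D (flip_scm R pre))"
    if "selects_parents R pre" for R
    using scm_solution_measurable[OF is_scm_flip[OF that] order_refl] prob_space_exo_law
    by (auto simp: scm_dist_def measurable_cong_sets[OF sets_exo_law refl]
        intro!: prob_space.prob_space_distr)
  show ?thesis
  proof (rule measure_eqI_countable[OF sets sets])
    show "countable (Pi\<^sub>E (verts G) D)"
      using countable_PiE[OF fin] countable_D by blast
    fix x assume x: "x \<in> Pi\<^sub>E (verts G) D"
    have "emeasure (scm_dist D (flip_scm R pre)) {x} = ennreal (\<Prod>v\<in>verts G. pmf (noise v) (x v))"
      if "selects_parents R pre" for R
      using measure_flip_scm_dist[OF that x]
        finite_measure.emeasure_eq_measure[OF prob_space.finite_measure[OF P[OF that]]] by simp
    then show "emeasure (scm_dist D (flip_scm R pre)) {x}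
        = emeasure (scm_dist D (flip_scm {} pre)) {x}"
      using pre by (simp add: selects_parents_def)
  qed
qed

section \<open>Augmented flip models and their observational equality\<close>

text \<open>The image repeats an injective code of the feature vector in every coordinate, so
  conditioning on the image amounts to conditioning on all features.\<close>

definition flip_ascm ::
  "'y \<Rightarrow> 'y \<Rightarrow> 'v \<Rightarrow> 'v set \<Rightarrow> ('v \<Rightarrow> 'v) \<Rightarrow> ('v, 'a, 'm::finite, 'y) ascm" where
  "flip_ascm yA yB t R pre =
     \<lparr>base = flip_scm R pre, image_exo = {},
      image_fn = (\<lambda>(x, u). \<chi> i. real (to_nat_on (Pi\<^sub>E (verts G) D) x)),
      label_fn = (\<lambda>(x, z). if x t = a t then yA else yB),
      full_law = Pi\<^sub>M slots slot_law\<rparr>"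

lemma flip_ascm_simps [simp]:
  "base (flip_ascm yA yB t R pre) = flip_scm R pre"
  "image_exo (flip_ascm yA yB t R pre) = {}"
  "image_fn (flip_ascm yA yB t R pre :: ('v, 'a, 'm::finite, 'y) ascm) (x, u)
     = (\<chi> i. real (to_nat_on (Pi\<^sub>E (verts G) D) x))"
  "label_fn (flip_ascm yA yB t R pre :: ('v, 'a, 'm, 'y) ascm) (x, z)
     = (if x t = a t then yA else yB)"
  "full_law (flip_ascm yA yB t R pre) = Pi\<^sub>M slots slot_law"
  by (simp_all add: flip_ascm_def)

lemma is_ascm_flip:
  assumes pre: "selects_parents R pre" and y: "yA \<in> DY" "yB \<in> DY"
  shows "is_ascm D DY (flip_ascm yA yB t R pre :: ('v, 'a, 'm::finite, 'y) ascm)"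
proof -
  let ?M = "flip_ascm yA yB t R pre :: ('v, 'a, 'm, 'y) ascm"
  have im: "(\<lambda>x. (\<chi> i. real (to_nat_on (Pi\<^sub>E (verts G) D) x)) :: real^'m)
      \<in> feature_space D (verts G) \<rightarrow>\<^sub>M borel"
    by (rule measurable_feature_space[OF fin countable_D]) auto
  have "image_fn ?M \<in> feature_space D (verts G) \<Otimes>\<^sub>M exo_space {} \<rightarrow>\<^sub>M borel"
    using measurable_compose[OF measurable_fst im] by (simp add: flip_ascm_def case_prod_unfold)
  moreover have la: "(\<lambda>x. if x t = a t then yA else yB)
      \<in> feature_space D (verts G) \<rightarrow>\<^sub>M count_space DY"
    by (rule measurable_feature_space[OF fin countable_D]) (use y in auto)
  have "label_fn ?M \<in> feature_space D (verts G) \<Otimes>\<^sub>M borel \<rightarrow>\<^sub>M count_space DY"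
    using measurable_compose[OF measurable_fst la] by (simp add: flip_ascm_def case_prod_unfold)
  moreover have "distr (Pi\<^sub>M slots slot_law) (exo_space slots) (\<lambda>u. restrict u slots)
      = distr (Pi\<^sub>M slots slot_law) (Pi\<^sub>M slots slot_law) (\<lambda>u. u)"
    by (rule distr_cong) (auto simp: sets_exo_law space_PiM PiE_iff extensional_restrict)
  ultimately show ?thesis
    using is_scm_flip[OF pre] prob_space_exo_law sets_exo_law[of slots]
    by (simp add: is_ascm_def distr_id2)
qed

lemma flip_ascm_GCP:
  assumes pre: "selects_parents R pre" and y: "yA \<in> DY" "yB \<in> DY" and t: "t \<in> T"
  shows "(flip_ascm yA yB t R pre :: ('v, 'a, 'm::finite, 'y) ascm) \<in> Omega_GCP D DY G T"
proof -
  have "positive_dist D (flip_scm R pre)"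
    using positive_flip_scm_dist[OF pre] by (simp add: positive_dist_def)
  then show ?thesis
    using is_ascm_flip[OF pre y] t y
    by (auto simp: Omega_GCP_def Omega_def scm_diagram_flip
        intro!: bexI[of _ "\<lambda>r. if r t = a t then yA else yB"])
qed

text \<open>Image and label are the same function \<open>?f\<close> of the features in both models,
  so equal feature laws give equal joint laws.\<close>

lemma joint_dist_flip:
  assumes pre: "selects_parents R pre" and y: "yA \<in> DY" "yB \<in> DY"
  shows "joint_dist D DY (flip_ascm yA yB t R pre :: ('v, 'a, 'm::finite, 'y) ascm)
    = joint_dist D DY (flip_ascm yA yB t {} pre)"
proof -
  let ?f = "\<lambda>x. (x, (\<chi> i. real (to_nat_on (Pi\<^sub>E (verts G) D) x)) :: real^'m,
    if x t = a t then yA else yB)"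
  let ?N = "feature_space D (verts G) \<Otimes>\<^sub>M (borel :: (real^'m) measure) \<Otimes>\<^sub>M count_space DY"
  have f: "?f \<in> feature_space D (verts G) \<rightarrow>\<^sub>M ?N"
    by (rule measurable_feature_space[OF fin countable_D])
      (use y in \<open>auto simp: space_pair_measure space_PiM\<close>)
  have "joint_dist D DY (flip_ascm yA yB t R pre :: ('v, 'a, 'm, 'y) ascm)
      = distr (scm_dist D (flip_scm R pre)) ?N ?f" if pre: "selects_parents R pre" for R
  proof -
    have "scm_solution (flip_scm R pre) \<in> Pi\<^sub>M slots slot_law \<rightarrow>\<^sub>M feature_space D (verts G)"
      using scm_solution_measurable[OF is_scm_flip[OF pre] order_refl]
      by (simp add: measurable_cong_sets[OF sets_exo_law refl])
    from distr_distr[OF f this] show ?thesis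
      by (simp add: joint_dist_def scm_dist_def comp_def features_def image_var_def label_var_def)
  qed
  then show ?thesis
    using pre flip_scm_dist_eq[OF pre] by (simp add: selects_parents_def)
qed

lemma label_flip_do:
  fixes M :: "('v, 'a, 'm::finite, 'y) ascm"
  assumes "M = flip_ascm yA yB t R pre"
  shows "label_var (ascm_do M W w) u
    = (if scm_solution (scm_do (flip_scm R pre) W w) u t = a t then yA else yB)"
  by (simp add: assms label_var_def features_def ascm_do_def flip_ascm_def)

text \<open>
  Where every vertex of \<open>W\<close> is observed at \<open>b\<close> and all others at \<open>a\<close>, forcing \<open>W\<close> to \<open>a\<close> toggles
  exactly one flip in the mechanism of each vertex of \<open>R\<close>.
\<close>

lemma flip_do_counterfactual:
  assumes pre: "selects_parents R pre" and R: "R \<subseteq> verts G" "R \<inter> W = {}" "pre ` R \<subseteq> R \<union> W"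
    and sol: "scm_solution (flip_scm R pre) u = (\<lambda>v\<in>verts G. if v \<in> W then b v else a v)"
    and w: "w \<in> Pi\<^sub>E W D" "\<And>v. v \<in> W \<Longrightarrow> w v = a v"
    and v: "v \<in> R"
  shows "scm_solution (scm_do (flip_scm R pre) W w) u v = b v"
proof -
  note N = is_scm_flip[OF pre]
  let ?x = "scm_solution (flip_scm R pre) u"
  let ?y = "scm_solution (scm_do (flip_scm R pre) W w) u"
  have wf: "wf (directed G)" using wf_scm_directed[OF N] by (simp add: scm_directed_flip)
  show ?thesis
    using wf v
  proof (induction v rule: wf_induct_rule)
    case (less v)
    have v: "v \<in> verts G" "v \<notin> W" using less(2) R by auto
    have edge: "(pre v, v) \<in> directed G" using pre less(2) by (simp add: selects_parents_def)
    then have p: "pre v \<in> verts G" "pre v \<in> R \<union> W" using dirG less(2) R(3) by auto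
    let ?n = "decode v (u (slot v v))"
    have x: "?x v = (if ?x (pre v) = b (pre v) then Transposition.transpose (a v) (b v) ?n else ?n)"
      using scm_solution_eq[OF N, of v u] v private_slot[OF v(1)] less(2) edge
      by (simp add: flip_def)
    have y: "?y v = (if ?y (pre v) = b (pre v) then Transposition.transpose (a v) (b v) ?n else ?n)"
      using scm_solution_do_notin[OF N w(1), of v u] v private_slot[OF v(1)] less(2) edge
      by (simp add: flip_def)
    have xv: "?x v = a v" using sol v by simp
    show ?case
    proof (cases "pre v \<in> W")
      case True
      \<comment> \<open>The factual flip is active, so the observed \<open>a v\<close> stems from
        noise \<open>b v\<close>; forcing the parent to \<open>a\<close> switches the flip off and
        exposes \<open>b v\<close>.\<close>
      then have "?x (pre v) = b (pre v)" using sol p by simp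
      then have "?n = b v"
        using x xv by (metis transpose_apply_first transpose_involutory)
      moreover have "?y (pre v) = a (pre v)"
        using scm_solution_do_in[OF N w(1), of "pre v" u] w(2) True p by simp
      ultimately show ?thesis using y ab[OF p(1)] by simp
    next
      case False
      \<comment> \<open>The factual flip is inactive, so the noise is \<open>a v\<close>; by
        induction the parent now takes the value \<open>b\<close>, which switches the flip
        on.\<close>
      then have "?x (pre v) = a (pre v)" using sol p by simp
      then have "?n = a v" using x xv ab[OF p(1)] by simp
      moreover have "?y (pre v) = b (pre v)"
        using less(1)[OF edge] p False by simp
      ultimately show ?thesis using y by simp
    qed
  qed
qed

text \<open>If the queries agreed, the indicator of \<open>C\<close>, a version in the model without
  flips, would be a version in the other model too. Integrating over one positive-probability image
  value then gives zero by one computation and a positive number by the other.\<close>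

lemma flip_query_neq:
  assumes pre: "selects_parents R pre" and R: "R \<subseteq> verts G" "R \<inter> W = {}" "pre ` R \<subseteq> R \<union> W"
    and W: "W \<subseteq> verts G" and t: "t \<in> R" and y: "yA \<in> DY" "yB \<in> DY" "yA \<noteq> yB"
  shows "query D DY W (flip_ascm yA yB t R pre :: ('v, 'a, 'm::finite, 'y) ascm)
    \<noteq> query D DY W (flip_ascm yA yB t {} pre)"
proof
  let ?M = "flip_ascm yA yB t R pre :: ('v, 'a, 'm, 'y) ascm"
  let ?N = "flip_ascm yA yB t {} pre :: ('v, 'a, 'm, 'y) ascm"
  let ?P = "Pi\<^sub>M slots slot_law"
  assume eq: "query D DY W ?M = query D DY W ?N"
  obtain w where w: "w \<in> Pi\<^sub>E W D" and w_a: "\<And>v. v \<in> W \<Longrightarrow> w v = a v"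
  proof
    show "restrict a W \<in> Pi\<^sub>E W D" using ab W by auto
  qed simp
  have pre0: "selects_parents {} pre" by (simp add: selects_parents_def)
  have tV: "t \<in> verts G" "t \<notin> W" using t R by auto
  define A where "A M = {u \<in> space (full_law M). label_var (ascm_do M W w) u = yA}"
    for M :: "('v, 'a, 'm, 'y) ascm"
  have cond_eq: "cond_prob_given ?P (image_var ?M) (A ?M) = cond_prob_given ?P (image_var ?N) (A ?N)"
    using fun_cong[OF fun_cong[OF eq, of w], of yA] w y by (simp add: query_def A_def)
  define enc :: "('v \<Rightarrow> 'a) \<Rightarrow> real^'m"
    where "enc x = (\<chi> i. real (to_nat_on (Pi\<^sub>E (verts G) D) x))" for x
  have cnt: "countable (Pi\<^sub>E (verts G) D)" using countable_PiE[OF fin] countable_D by blast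
  have enc_inj: "x = x'" if "x \<in> Pi\<^sub>E (verts G) D" "x' \<in> Pi\<^sub>E (verts G) D" "enc x = enc x'" for x x'
    using that cnt by (simp add: enc_def vec_eq_iff)
  have img: "image_var (flip_ascm yA yB t R pre :: ('v, 'a, 'm, 'y) ascm) u
      = enc (scm_solution (flip_scm R pre) u)" for u R
    by (simp add: image_var_def features_def enc_def)
  \<comment> \<open>These are the images that reveal the factual value \<open>a t\<close>;
    countability makes the set Borel.\<close>
  define C where "C = enc ` {x \<in> Pi\<^sub>E (verts G) D. x t = a t}"
  have "countable C"
    unfolding C_def by (rule countable_image, rule countable_subset[OF _ cnt]) auto
  then have C: "C \<in> sets borel"
    by (rule sets.countable[rotated]) auto
  have in_C: "enc x \<in> C \<longleftrightarrow> x t = a t" if "x \<in> Pi\<^sub>E (verts G) D" for x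
    using that enc_inj by (auto simp: C_def)
  \<comment> \<open>Without flips \<open>t\<close> depends only on its own noise, so the
    counterfactual event is the factual event that the image lies in \<open>C\<close>.\<close>
  have "scm_solution (scm_do (flip_scm {} pre) W w) u t = scm_solution (flip_scm {} pre) u t" for u
    using scm_solution_do_notin[OF is_scm_flip[OF pre0] w, of t u]
      scm_solution_eq[OF is_scm_flip[OF pre0], of t u] tV private_slot[OF tV(1)]
    by (simp add: flip_def)
  then have "A ?N = image_var ?N -` C \<inter> space ?P"
    using in_C scm_solution_in_PiE[OF is_scm_flip[OF pre0]] y
    by (auto simp: A_def label_flip_do[OF refl] img)
  then have "indicator C \<in> cond_prob_given ?P (image_var ?N) (A ?N)"
    using indicator_in_cond_prob_given[OF prob_space_exo_law _ C, of "image_var ?N"]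
      ascm_measurable(2)[OF is_ascm_flip[OF pre0 y(1,2), of t, where 'm = 'm]] by simp
  then have ind: "indicator C \<in> cond_prob_given ?P (image_var ?M) (A ?M)"
    using cond_eq by simp
  have X: "image_var ?M \<in> ?P \<rightarrow>\<^sub>M borel"
    using ascm_measurable(2)[OF is_ascm_flip[OF pre y(1,2), of t, where 'm = 'm]] by simp
  have "scm_solution (scm_do (flip_scm R pre) W w) \<in> ?P \<rightarrow>\<^sub>M feature_space D (verts G)"
    using scm_solution_measurable[OF is_scm_do[OF is_scm_flip[OF pre] w], of slots]
    by (simp add: measurable_cong_sets[OF sets_exo_law refl])
  moreover have "{x \<in> Pi\<^sub>E (verts G) D. x t = a t} \<in> sets (feature_space D (verts G))"
    using sets_feature_space[OF fin, of D] countable_D by auto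
  ultimately have "scm_solution (scm_do (flip_scm R pre) W w) -` {x \<in> Pi\<^sub>E (verts G) D. x t = a t}
      \<inter> space ?P \<in> sets ?P"
    by (rule measurable_sets)
  also have "scm_solution (scm_do (flip_scm R pre) W w) -` {x \<in> Pi\<^sub>E (verts G) D. x t = a t}
      \<inter> space ?P = A ?M"
    using scm_solution_in_PiE[OF is_scm_do[OF is_scm_flip[OF pre] w]] y
    by (auto simp: A_def label_flip_do[OF refl])
  finally have A: "A ?M \<in> sets ?P" .
  \<comment> \<open>This is the factual profile at which forcing \<open>W\<close> to
    \<open>a\<close> moves every vertex of \<open>R\<close> to \<open>b\<close>.\<close>
  define x where "x = (\<lambda>v\<in>verts G. if v \<in> W then b v else a v)"
  have x: "x \<in> Pi\<^sub>E (verts G) D" using ab by (auto simp: x_def)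
  let ?E = "image_var ?M -` {enc x} \<inter> space ?P"
  have E: "?E = scm_solution (flip_scm R pre) -` {x} \<inter> space ?P"
    using enc_inj[OF scm_solution_in_PiE[OF is_scm_flip[OF pre], simplified] x] by (auto simp: img)
  \<comment> \<open>On \<open>?E\<close> the intervention sends \<open>t\<close> to
    \<open>b t\<close>, so the counterfactual label is \<open>yB\<close>, although \<open>t\<close>
    is factually at \<open>a t\<close> and the image lies in \<open>C\<close>.\<close>
  have "A ?M \<inter> ?E = {}"
    using flip_do_counterfactual[OF pre R _ w w_a t] ab[OF tV(1)] y
    unfolding E by (auto simp: A_def label_flip_do[OF refl] x_def)
  then have "(\<integral>u\<in>?E. indicator C (image_var ?M u) \<partial>?P) = (0 :: real)"
    using ind cond_prob_given_iff[OF prob_space_exo_law X A, of "indicator C"] by auto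
  moreover have "(\<integral>u\<in>?E. indicator C (image_var ?M u) \<partial>?P) = measure ?P ?E"
  proof -
    have "enc x \<in> C" using in_C[OF x] tV by (simp add: x_def)
    then have "(\<integral>u\<in>?E. indicator C (image_var ?M u) \<partial>?P)
        = integral\<^sup>L ?P (indicator ?E :: _ \<Rightarrow> real)"
      unfolding set_lebesgue_integral_def
      by (intro Bochner_Integration.integral_cong) (auto simp: indicator_def)
    then show ?thesis by simp
  qed
  moreover have "measure ?P ?E > 0"
  proof -
    have "measure ?P ?E = measure (scm_dist D (flip_scm R pre)) {x}"
      using measure_features_eq[OF is_ascm_flip[OF pre y(1,2), of t, where 'm = 'm], of "{x}"]
        fin countable_D x unfolding E by (simp add: features_def[abs_def])
    then show ?thesis using positive_flip_scm_dist[OF pre x] by simp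
  qed
  ultimately show False by simp
qed

end

section \<open>Choice of the flips and conclusion\<close>

lemma causally_interpretableD:
  assumes "causally_interpretable D DY C Q" "M1 \<in> C" "M2 \<in> C"
    and "joint_dist D DY M1 = joint_dist D DY M2"
  shows "Q M1 = Q M2"
  using assms unfolding causally_interpretable_def by (elim ballE) auto

lemma not_causally_interpretable_GCP:
  fixes G :: "'v diagram" and D :: "'v \<Rightarrow> 'a set" and DY :: "'y set"
  assumes G: "causal_diagram G"
    and D: "\<And>v. v \<in> verts G \<Longrightarrow> countable (D v) \<and> (\<exists>a\<in>D v. \<exists>b\<in>D v. a \<noteq> b)"
    and DY: "\<exists>a\<in>DY. \<exists>b\<in>DY. a \<noteq> b"
    and T: "T \<subseteq> verts G" "\<not> T \<subseteq> W \<union> nondescendants G W" and W: "W \<subseteq> verts G"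
  shows "\<not> causally_interpretable D DY (Omega_GCP D DY G T :: ('v, 'a, 'm::finite, 'y) ascm set)
    (query D DY W)"
proof -
  have "\<forall>v. \<exists>p. v \<in> verts G \<longrightarrow> fst p \<in> D v \<and> snd p \<in> D v \<and> fst p \<noteq> snd p"
    using D by (metis fst_conv snd_conv)
  then obtain p where p: "\<And>v. v \<in> verts G \<Longrightarrow> fst (p v) \<in> D v \<and> snd (p v) \<in> D v \<and> fst (p v) \<noteq> snd (p v)"
    by metis
  interpret flip_models G D "\<lambda>v. fst (p v)" "\<lambda>v. snd (p v)"
    by unfold_locales (use G D p in auto)
  obtain yA yB where y: "yA \<in> DY" "yB \<in> DY" "yA \<noteq> yB" using DY by auto
  define R where "R = {v \<in> verts G - W. \<exists>w\<in>W. (w, v) \<in> (directed G)\<^sup>*}"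
  obtain t where "t \<in> T" "t \<notin> W" "t \<notin> nondescendants G W"
    using T by auto
  then have t: "t \<in> T" "t \<in> R"
    using T(1) by (auto simp: R_def nondescendants_iff)
  \<comment> \<open>Take the last edge of a directed path from \<open>W\<close> to \<open>v\<close>;
    the path is nontrivial since \<open>v\<close> lies outside \<open>W\<close>. Its source is in
    \<open>W\<close> or is itself a descendant of \<open>W\<close> outside \<open>W\<close>.\<close>
  have "\<exists>q. (q, v) \<in> directed G \<and> q \<in> R \<union> W" if v: "v \<in> R" for v
  proof -
    obtain w where w: "w \<in> W" "(w, v) \<in> (directed G)\<^sup>*" "v \<notin> W"
      using v by (auto simp: R_def)
    then obtain q where "(w, q) \<in> (directed G)\<^sup>*" "(q, v) \<in> directed G"
      by (metis rtranclE)
    then show ?thesis using w dirG(1) by (auto simp: R_def)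
  qed
  then obtain pre where pre: "\<And>v. v \<in> R \<Longrightarrow> (pre v, v) \<in> directed G \<and> pre v \<in> R \<union> W"
    by metis
  then have sel: "selects_parents R pre" and sel0: "selects_parents {} pre"
    by (simp_all add: selects_parents_def)
  have R: "R \<subseteq> verts G" "R \<inter> W = {}"
    by (auto simp: R_def)
  have "pre ` R \<subseteq> R \<union> W"
    using pre by blast
  then have neq: "query D DY W (flip_ascm yA yB t R pre :: ('v, 'a, 'm, 'y) ascm)
      \<noteq> query D DY W (flip_ascm yA yB t {} pre)"
    by (rule flip_query_neq[OF sel R _ W t(2) y])
  show ?thesis
  proof
    assume "causally_interpretable D DY (Omega_GCP D DY G T :: ('v, 'a, 'm, 'y) ascm set)
      (query D DY W)"
    then have "query D DY W (flip_ascm yA yB t R pre :: ('v, 'a, 'm, 'y) ascm)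
        = query D DY W (flip_ascm yA yB t {} pre)"
      by (rule causally_interpretableD[OF _ flip_ascm_GCP[OF sel y(1,2) t(1)]
        flip_ascm_GCP[OF sel0 y(1,2) t(1)] joint_dist_flip[OF sel y(1,2)]])
    with neq show False ..
  qed
qed

theorem theorem2:
  fixes G :: "'v diagram"
    and D :: "'v \<Rightarrow> 'a set"
    and DY :: "'y set"
    and Ws :: "'v set set"
  assumes "causal_diagram G"
    and "\<forall>v\<in>verts G. countable (D v) \<and> (\<exists>a\<in>D v. \<exists>b\<in>D v. a \<noteq> b)"
    and "countable DY \<and> (\<exists>a\<in>DY. \<exists>b\<in>DY. a \<noteq> b)"
    and "\<forall>W\<in>Ws. W \<subseteq> verts G"
  shows "(\<exists>!S. is_Max_T_Ad TYPE('m::finite) D DY G Ws S) \<and>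
         Max_T_Ad TYPE('m) D DY G Ws
           = verts G \<inter> (\<Inter>W\<in>Ws. W \<union> nondescendants G W) \<and>
         (\<forall>T. T \<subseteq> verts G \<longrightarrow>
            (T \<in> T_Ad TYPE('m) D DY G Ws \<longleftrightarrow> T \<subseteq> Max_T_Ad TYPE('m) D DY G Ws))"
proof -
  \<comment> \<open>For an empty collection the inner intersection is the whole type; cutting with
    \<open>verts G\<close> gives the right value, all features.\<close>
  define S where "S = verts G \<inter> (\<Inter>W\<in>Ws. W \<union> nondescendants G W)"
  have D: "countable (D v) \<and> (\<exists>a\<in>D v. \<exists>b\<in>D v. a \<noteq> b)" if "v \<in> verts G" for v
    using assms(2) that by simp
  have fin: "finite (verts G)"
    using assms(1) by (simp add: causal_diagram_def)
  have D': "countable (D v) \<and> D v \<noteq> {}" if "v \<in> verts G" for v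
    using D[OF that] by blast
  have "causally_interpretable D DY (Omega_GCP D DY G T :: ('v, 'a, 'm, 'y) ascm set) (query D DY W)
      \<longleftrightarrow> T \<subseteq> W \<union> nondescendants G W" if T: "T \<subseteq> verts G" and W: "W \<in> Ws" for T W
  proof -
    have "W \<subseteq> verts G" using assms(4) W by simp
    note not_ci = not_causally_interpretable_GCP[OF assms(1) D conjunct2[OF assms(3)] T _ this]
    show ?thesis
    proof (cases "T \<subseteq> W \<union> nondescendants G W")
      case True
      have "causally_interpretable D DY (Omega_GCP D DY G T :: ('v, 'a, 'm, 'y) ascm set)
          (query D DY W)"
        by (rule causally_interpretable_GCP[OF fin D' T True])
      with True show ?thesis by simp
    next
      case False
      have "\<not> causally_interpretable D DY (Omega_GCP D DY G T :: ('v, 'a, 'm, 'y) ascm set)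
          (query D DY W)"
        by (rule not_ci[OF _ False])
      with False show ?thesis by simp
    qed
  qed
  then have "T \<in> T_Ad TYPE('m) D DY G Ws \<longleftrightarrow>
      T \<subseteq> verts G \<and> (\<forall>W\<in>Ws. T \<subseteq> W \<union> nondescendants G W)" for T
    unfolding T_Ad_def by (simp cong: conj_cong)
  then have T_Ad: "T \<in> T_Ad TYPE('m) D DY G Ws \<longleftrightarrow> T \<subseteq> S" for T
    unfolding S_def by (simp only: le_inf_iff le_INF_iff)
  \<comment> \<open>The admissible sets are exactly the subsets of \<open>S\<close>, so
    \<open>S\<close> is the greatest of them and hence the only maximal one.\<close>
  then have is_max: "is_Max_T_Ad TYPE('m) D DY G Ws S' \<longleftrightarrow> S' = S" for S'
    unfolding is_Max_T_Ad_def by blast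
  have "\<exists>!S. is_Max_T_Ad TYPE('m) D DY G Ws S"
    by (simp add: is_max)
  moreover have "Max_T_Ad TYPE('m) D DY G Ws = S"
    unfolding Max_T_Ad_def by (rule the_equality) (simp_all add: is_max)
  ultimately show ?thesis
    using T_Ad by (simp add: S_def)
qed

end
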